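(* Let $v\ge 0$. Then $$\dim_{\mathrm H}\mathcal{W}_v=\dim_{\mathrm H}\mathcal{V}_v=\begin{cases}4 & \text{when } v\le 2,\\ \dfrac{8}{v} & \text{when } v>2.\end{cases}$$
   Context: $\mathbb{H}$ denotes the real quaternions $\xi=a+bi+cj+dk$, identified with $\mathbb{R}^4$, with Euclidean norm $|\xi|_2=(a^2+b^2+c^2+d^2)^{1/2}$. The Hurwitz integers $\mathcal{H}$ are the quaternions $a+bi+cj+dk$ with either all of $a,b,c,d\in\mathbb{Z}$ or all of $a,b,c,d\in\mathbb{Z}+\frac12$. Let $\overline\Delta=[0,1]^3\times[0,1/2]\subset\mathbb{H}$. Define $$\mathcal{W}_v=\{\xi\in\mathbb{H}: |\xi-\mathbf{p}\mathbf{q}^{-1}|_2<|\mathbf{q}|_2^{-v}\text{ for infinitely many pairs }\mathbf{p},\mathbf{q}\in\mathcal{H},\ \mathbf{q}\ne0\}$$ (pairs are not required to be coprime) and $\mathcal{V}_v=\mathcal{W}_v\cap\overline\Delta$. $\dim_{\mathrm H}$ denotes Hausdorff dimension. *)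

theory Defs
  imports "HOL-Analysis.Analysis"
begin

section \<open>The real quaternions\<close>

codatatype quat = Quat (qRe: real) (qIm1: real) (qIm2: real) (qIm3: real)

lemma quat_eq_iff:
  "x = y \<longleftrightarrow> qRe x = qRe y \<and> qIm1 x = qIm1 y \<and> qIm2 x = qIm2 y \<and> qIm3 x = qIm3 y"
  by (auto intro: quat.expand)

instantiation quat :: ab_group_add
begin

primcorec zero_quat where
  "qRe 0 = 0" | "qIm1 0 = 0" | "qIm2 0 = 0" | "qIm3 0 = 0"

primcorec plus_quat where
  "qRe (x + y) = qRe x + qRe y"
| "qIm1 (x + y) = qIm1 x + qIm1 y"
| "qIm2 (x + y) = qIm2 x + qIm2 y"
| "qIm3 (x + y) = qIm3 x + qIm3 y"

primcorec uminus_quat where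
  "qRe (- x) = - qRe x"
| "qIm1 (- x) = - qIm1 x"
| "qIm2 (- x) = - qIm2 x"
| "qIm3 (- x) = - qIm3 x"

primcorec minus_quat where
  "qRe (x - y) = qRe x - qRe y"
| "qIm1 (x - y) = qIm1 x - qIm1 y"
| "qIm2 (x - y) = qIm2 x - qIm2 y"
| "qIm3 (x - y) = qIm3 x - qIm3 y"

instance
  by standard (simp_all add: quat_eq_iff)

end

instantiation quat :: ring_1
begin

primcorec one_quat where
  "qRe 1 = 1" | "qIm1 1 = 0" | "qIm2 1 = 0" | "qIm3 1 = 0"

primcorec times_quat where
  "qRe (x * y) = qRe x * qRe y - qIm1 x * qIm1 y - qIm2 x * qIm2 y - qIm3 x * qIm3 y"
| "qIm1 (x * y) = qRe x * qIm1 y + qIm1 x * qRe y + qIm2 x * qIm3 y - qIm3 x * qIm2 y"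
| "qIm2 (x * y) = qRe x * qIm2 y - qIm1 x * qIm3 y + qIm2 x * qRe y + qIm3 x * qIm1 y"
| "qIm3 (x * y) = qRe x * qIm3 y + qIm1 x * qIm2 y - qIm2 x * qIm1 y + qIm3 x * qRe y"

instance
  by standard (simp_all add: quat_eq_iff algebra_simps)

end

lemma one_quat_eq: "1 = Quat 1 0 0 0"
  by (simp add: quat_eq_iff)

lemma quat_hamilton_relations:
  "Quat 0 1 0 0 * Quat 0 1 0 0 = -1"
  "Quat 0 0 1 0 * Quat 0 0 1 0 = -1"
  "Quat 0 0 0 1 * Quat 0 0 0 1 = -1"
  "Quat 0 1 0 0 * Quat 0 0 1 0 = Quat 0 0 0 1"
  "Quat 0 0 1 0 * Quat 0 0 0 1 = Quat 0 1 0 0"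
  "Quat 0 0 0 1 * Quat 0 1 0 0 = Quat 0 0 1 0"
  by (simp_all add: quat_eq_iff)

instantiation quat :: real_algebra_1
begin

primcorec scaleR_quat where
  "qRe (scaleR r x) = r * qRe x"
| "qIm1 (scaleR r x) = r * qIm1 x"
| "qIm2 (scaleR r x) = r * qIm2 x"
| "qIm3 (scaleR r x) = r * qIm3 x"

instance
  by standard (simp_all add: quat_eq_iff algebra_simps)

end

instantiation quat :: real_inner
begin

definition inner_quat_def:
  "inner x y = qRe x * qRe y + qIm1 x * qIm1 y + qIm2 x * qIm2 y + qIm3 x * qIm3 y"

definition norm_quat_def:
  "norm x = sqrt ((qRe x)\<^sup>2 + (qIm1 x)\<^sup>2 + (qIm2 x)\<^sup>2 + (qIm3 x)\<^sup>2)"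

definition sgn_quat_def: "sgn (x :: quat) = x /\<^sub>R norm x"

definition dist_quat_def: "dist (x :: quat) y = norm (x - y)"

definition uniformity_quat_def:
  "(uniformity :: (quat \<times> quat) filter) = (INF e\<in>{0 <..}. principal {(x, y). dist x y < e})"

definition open_quat_def:
  "open (U :: quat set) \<longleftrightarrow> (\<forall>x\<in>U. eventually (\<lambda>(x', y). x' = x \<longrightarrow> y \<in> U) uniformity)"

instance
proof
  fix x y z :: quat and r :: real
  show "inner x x = 0 \<longleftrightarrow> x = 0"
    by (simp add: inner_quat_def quat_eq_iff add_nonneg_eq_0_iff)
qed (simp_all add: inner_quat_def norm_quat_def sgn_quat_def dist_quat_def
      uniformity_quat_def open_quat_def algebra_simps power2_eq_square)

end

instantiation quat :: real_normed_div_algebra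
begin

primcorec inverse_quat where
  "qRe (inverse x) = qRe x / ((qRe x)\<^sup>2 + (qIm1 x)\<^sup>2 + (qIm2 x)\<^sup>2 + (qIm3 x)\<^sup>2)"
| "qIm1 (inverse x) = - qIm1 x / ((qRe x)\<^sup>2 + (qIm1 x)\<^sup>2 + (qIm2 x)\<^sup>2 + (qIm3 x)\<^sup>2)"
| "qIm2 (inverse x) = - qIm2 x / ((qRe x)\<^sup>2 + (qIm1 x)\<^sup>2 + (qIm2 x)\<^sup>2 + (qIm3 x)\<^sup>2)"
| "qIm3 (inverse x) = - qIm3 x / ((qRe x)\<^sup>2 + (qIm1 x)\<^sup>2 + (qIm2 x)\<^sup>2 + (qIm3 x)\<^sup>2)"

definition "x div y = x * inverse y" for x y :: quat

instance
proof
  fix x y :: quat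
  have nz: "(qRe x)\<^sup>2 + (qIm1 x)\<^sup>2 + (qIm2 x)\<^sup>2 + (qIm3 x)\<^sup>2 \<noteq> 0" if "x \<noteq> 0"
    using that by (simp add: quat_eq_iff add_nonneg_eq_0_iff)
  show "inverse x * x = 1" if "x \<noteq> 0"
    by (rule quat_eq_iff[THEN iffD2])
      (use nz[OF that] in \<open>simp_all add: divide_simps power2_eq_square\<close>)
  show "x * inverse x = 1" if "x \<noteq> 0"
    by (rule quat_eq_iff[THEN iffD2])
      (use nz[OF that] in \<open>simp_all add: divide_simps power2_eq_square\<close>)
  show "x div y = x * inverse y"
    by (simp add: divide_quat_def)
  show "inverse (0 :: quat) = 0"
    by (simp add: quat_eq_iff)
  show "norm (x * y) = norm x * norm y"
    unfolding norm_quat_def real_sqrt_mult [symmetric]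
    by (rule arg_cong[of _ _ sqrt], simp only: times_quat.sel, algebra)
qed

end

instantiation quat :: euclidean_space
begin

definition Basis_quat_def: "Basis = {1, Quat 0 1 0 0, Quat 0 0 1 0, Quat 0 0 0 1}"

instance
proof
  fix x y :: quat
  show "inner x y = (if x = y then 1 else 0)" if "x \<in> Basis" "y \<in> Basis"
    using that unfolding Basis_quat_def one_quat_eq by (elim insertE emptyE) (simp_all add: inner_quat_def)
  show "(\<forall>u\<in>Basis. inner x u = 0) \<longleftrightarrow> x = 0"
    unfolding Basis_quat_def quat_eq_iff[of x 0] by (simp add: inner_quat_def)
qed (simp_all add: Basis_quat_def)

end

lemma DIM_quat [simp]: "DIM(quat) = 4"
  by (simp add: Basis_quat_def one_quat_eq)


section \<open>Hausdorff dimension\<close>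

text \<open>
  The \<open>s\<close>-th power of the diameter, with the convention that the diameter of a nonempty set
  to the power \<open>0\<close> is \<open>1\<close> (whereas \<open>0 powr 0 = 0\<close>), and that the empty set contributes \<open>0\<close>.
\<close>

definition diam_powr :: "real \<Rightarrow> 'a::metric_space set \<Rightarrow> ennreal" where
  "diam_powr s U = (if U = {} then 0 else if s = 0 then 1 else ennreal (diameter U powr s))"

text \<open>
  Boundedness has to be required explicitly, since \<^const>\<open>diameter\<close> is real-valued and
  therefore meaningless for unbounded sets.
\<close>

definition hausdorff_premeasure :: "real \<Rightarrow> real \<Rightarrow> 'a::metric_space set \<Rightarrow> ennreal" where
  "hausdorff_premeasure s \<delta> A =
     (INF U \<in> {U :: nat \<Rightarrow> 'a set. A \<subseteq> (\<Union>n. U n) \<and> (\<forall>n. bounded (U n) \<and> diameter (U n) \<le> \<delta>)}.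
        \<Sum>n. diam_powr s (U n))"

definition hausdorff_measure :: "real \<Rightarrow> 'a::metric_space set \<Rightarrow> ennreal" where
  "hausdorff_measure s A = (SUP \<delta> \<in> {0<..}. hausdorff_premeasure s \<delta> A)"

definition hausdorff_dim :: "'a::metric_space set \<Rightarrow> ennreal" where
  "hausdorff_dim A = (INF s \<in> {s :: real. 0 \<le> s \<and> hausdorff_measure s A = 0}. ennreal s)"


section \<open>Approximation by ratios of Hurwitz integers\<close>

definition hurwitz_integers :: "quat set" where
  "hurwitz_integers =
     {x. qRe x \<in> \<int> \<and> qIm1 x \<in> \<int> \<and> qIm2 x \<in> \<int> \<and> qIm3 x \<in> \<int>} \<union>
     {x. qRe x - 1/2 \<in> \<int> \<and> qIm1 x - 1/2 \<in> \<int> \<and> qIm2 x - 1/2 \<in> \<int> \<and> qIm3 x - 1/2 \<in> \<int>}"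

definition Delta_closure :: "quat set" where
  "Delta_closure = {x. qRe x \<in> {0..1} \<and> qIm1 x \<in> {0..1} \<and> qIm2 x \<in> {0..1} \<and> qIm3 x \<in> {0..1/2}}"

text \<open>
  It is the pairs that are counted, not the quotients; the pairs need not be coprime.
\<close>

definition W_approx :: "real \<Rightarrow> quat set" where
  "W_approx v =
     {\<xi>. infinite {(p, q). p \<in> hurwitz_integers \<and> q \<in> hurwitz_integers \<and> q \<noteq> 0 \<and>
                      norm (\<xi> - p * inverse q) < norm q powr (- v)}}"

definition V_approx :: "real \<Rightarrow> quat set" where
  "V_approx v = W_approx v \<inter> Delta_closure"

end

theory Submission
  imports Defs
begin

text \<open>
  Upper bound: grouping the pairs by \<open>2 ^ k \<le> norm q < 2 ^ Suc k\<close>, a bounded part of the set is covered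
  infinitely often by \<open>O(2 ^ (8 * k))\<close> balls of radius \<open>2 powr (- v * k)\<close>, and the Hausdorff--Cantelli
  lemma applies for \<open>s > 8 / v\<close>.

  Lower bound for \<open>v > 2\<close> (the case \<open>v \<le> 2\<close> follows by letting the exponent decrease to 2): already
  the quaternions with integer coordinates suffice. By Dirichlet's theorem every point of a ball of
  radius \<open>r\<close> is close to some \<open>p * inverse q\<close> with \<open>norm q \<le> 2 * M\<close>, and comparing volumes, at least
  half of the ball needs \<open>norm q \<ge> M / 40\<close>; so the ball contains about \<open>r ^ 4 * M ^ 8\<close> such quotients
  separated by \<open>1 / M\<^sup>2\<close>. Given a countable cover with \<open>\<Sum> diam powr s\<close> small, one chooses nested balls
  around such quotients, each time by averaging the weight of the cover over the candidates; the
  common point of the balls is well approximable and lies in no set of the cover.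
\<close>

section \<open>Hausdorff measure\<close>

lemma hausdorff_premeasure_mono:
  "A \<subseteq> B \<Longrightarrow> hausdorff_premeasure s \<delta> A \<le> hausdorff_premeasure s \<delta> B"
  unfolding hausdorff_premeasure_def by (rule INF_superset_mono) auto

lemma hausdorff_measure_mono:
  "A \<subseteq> B \<Longrightarrow> hausdorff_measure s A \<le> hausdorff_measure s B"
  unfolding hausdorff_measure_def by (rule SUP_mono) (blast intro: hausdorff_premeasure_mono)

lemma hausdorff_measure_eq_0_iff:
  "hausdorff_measure s A = 0 \<longleftrightarrow> (\<forall>\<delta>>0. hausdorff_premeasure s \<delta> A = 0)"
  unfolding hausdorff_measure_def bot_ennreal[symmetric] by (subst SUP_bot_conv) auto

lemma hausdorff_dim_mono: "A \<subseteq> B \<Longrightarrow> hausdorff_dim A \<le> hausdorff_dim B"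
  unfolding hausdorff_dim_def
proof (rule INF_superset_mono)
  assume "A \<subseteq> B"
  then have "hausdorff_measure s A = 0" if "hausdorff_measure s B = 0" for s
    using hausdorff_measure_mono[of A B s] that by simp
  then show "{s. 0 \<le> s \<and> hausdorff_measure s B = 0} \<subseteq> {s. 0 \<le> s \<and> hausdorff_measure s A = 0}"
    by blast
qed simp

lemma hausdorff_premeasure_le_diam_powr:
  assumes "bounded A" "diameter A \<le> \<delta>" "0 \<le> \<delta>"
  shows "hausdorff_premeasure s \<delta> A \<le> diam_powr s A"
proof -
  \<comment> \<open>Padding by empty sets is harmless: \<open>diam_powr\<close> gives them 0 for
    every \<open>s\<close>, including \<open>s = 0\<close>.\<close>
  define U where "U n = (if n = 0 then A else {})" for n :: nat
  have "(\<Sum>n. diam_powr s (U n)) = (\<Sum>n\<in>{0}. diam_powr s (U n))"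
    by (rule suminf_finite) (auto simp: U_def diam_powr_def)
  then have "(\<Sum>n. diam_powr s (U n)) = diam_powr s A"
    by (simp add: U_def)
  moreover have "U \<in> {U. A \<subseteq> (\<Union>n. U n) \<and> (\<forall>n. bounded (U n) \<and> diameter (U n) \<le> \<delta>)}"
    using assms by (auto simp: U_def intro!: exI[of _ 0])
  ultimately show ?thesis
    unfolding hausdorff_premeasure_def by (metis (no_types, lifting) INF_lower)
qed

lemma hausdorff_premeasure_empty [simp]:
  "0 \<le> \<delta> \<Longrightarrow> hausdorff_premeasure s \<delta> {} = 0"
  using hausdorff_premeasure_le_diam_powr[of "{}" \<delta> s] by (simp add: diam_powr_def)

text \<open>If the right-hand side is finite, each \<open>A n\<close> has a cover that is optimal up
  to \<open>e / 2 ^ (n + 1)\<close>; the pairing \<open>prod_decode\<close> lists all these covers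
  as one sequence.\<close>

lemma hausdorff_premeasure_UN_le:
  fixes A :: "nat \<Rightarrow> 'a::metric_space set"
  shows "hausdorff_premeasure s \<delta> (\<Union>n. A n) \<le> (\<Sum>n. hausdorff_premeasure s \<delta> (A n))"
proof (rule ennreal_le_epsilon)
  fix e :: real
  assume e: "0 < e" and fin: "(\<Sum>n. hausdorff_premeasure s \<delta> (A n)) < top"
  have "\<exists>U. A n \<subseteq> (\<Union>m. U m) \<and> (\<forall>m. bounded (U m) \<and> diameter (U m) \<le> \<delta>) \<and>
      (\<Sum>m. diam_powr s (U m)) \<le> hausdorff_premeasure s \<delta> (A n) + ennreal (e * (1/2)^Suc n)" for n
  proof -
    have "hausdorff_premeasure s \<delta> (A n) \<noteq> \<infinity>"
      using ennreal_suminf_lessD[OF fin, of n] by auto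
    with e show ?thesis
      using INF_approx_ennreal[of "e * (1/2)^Suc n", OF _ hausdorff_premeasure_def[of s \<delta> "A n"]]
      by (auto simp del: power_Suc intro: less_imp_le)
  qed
  then obtain U where U: "\<And>n. A n \<subseteq> (\<Union>m. U n m)" "\<And>n m. bounded (U n m)" "\<And>n m. diameter (U n m) \<le> \<delta>"
    "\<And>n. (\<Sum>m. diam_powr s (U n m)) \<le> hausdorff_premeasure s \<delta> (A n) + ennreal (e * (1/2)^Suc n)"
    by metis
  define V where "V i = (case prod_decode i of (n, m) \<Rightarrow> U n m)" for i
  have "hausdorff_premeasure s \<delta> (\<Union>n. A n) \<le> (\<Sum>i. diam_powr s (V i))"
  proof -
    have "(\<Union>n. A n) \<subseteq> (\<Union>i. V i)"
    proof safe
      fix x n assume "x \<in> A n"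
      then obtain m where "x \<in> U n m" using U(1) by blast
      then have "x \<in> V (prod_encode (n, m))" by (simp add: V_def)
      then show "x \<in> (\<Union>i. V i)" by blast
    qed
    moreover have "bounded (V i) \<and> diameter (V i) \<le> \<delta>" for i
      by (simp add: V_def U(2,3) split: prod.splits)
    ultimately show ?thesis
      unfolding hausdorff_premeasure_def by (intro INF_lower) auto
  qed
  also have "\<dots> = (\<Sum>n. \<Sum>m. diam_powr s (U n m))"
    using suminf_ennreal_2dimen[of "\<lambda>n. \<Sum>m. diam_powr s (U n m)" "\<lambda>(n, m). diam_powr s (U n m)"]
    by (simp add: V_def case_prod_beta)
  also have "\<dots> \<le> (\<Sum>n. hausdorff_premeasure s \<delta> (A n) + ennreal (e * (1/2)^Suc n))"
    by (intro suminf_le U summableI)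
  also have "\<dots> = (\<Sum>n. hausdorff_premeasure s \<delta> (A n)) + (\<Sum>n. ennreal (e * (1/2)^Suc n))"
    by (intro suminf_add[symmetric] summableI)
  also have "(\<Sum>n. ennreal (e * (1/2)^Suc n)) = ennreal (e * 1)"
    using e by (intro suminf_ennreal_eq sums_mult power_half_series) auto
  finally show "hausdorff_premeasure s \<delta> (\<Union>n. A n) \<le> (\<Sum>n. hausdorff_premeasure s \<delta> (A n)) + ennreal e"
    by simp
qed

lemma hausdorff_premeasure_finite_UN_le:
  assumes "finite I" "0 \<le> \<delta>"
  shows "hausdorff_premeasure s \<delta> (\<Union>i\<in>I. A i) \<le> (\<Sum>i\<in>I. hausdorff_premeasure s \<delta> (A i))"
  using assms(1)
proof induction
  case empty
  then show ?case using assms by simp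
next
  case (insert i I)
  have "hausdorff_premeasure s \<delta> (\<Union>i\<in>insert i I. A i) =
      hausdorff_premeasure s \<delta> (\<Union>n. binaryset (A i) (\<Union>i\<in>I. A i) n)"
    by (simp add: UN_binaryset_eq)
  also have "\<dots> \<le> (\<Sum>n. hausdorff_premeasure s \<delta> (binaryset (A i) (\<Union>i\<in>I. A i) n))"
    by (rule hausdorff_premeasure_UN_le)
  also have "\<dots> = hausdorff_premeasure s \<delta> (A i) + hausdorff_premeasure s \<delta> (\<Union>i\<in>I. A i)"
    using assms by (intro suminf_binaryset_eq) simp
  finally show ?case
    using insert by (auto intro: order_trans add_left_mono)
qed

lemma hausdorff_measure_UN_eq_0:
  fixes A :: "nat \<Rightarrow> 'a::metric_space set"
  assumes "\<And>n. hausdorff_measure s (A n) = 0"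
  shows "hausdorff_measure s (\<Union>n. A n) = 0"
  unfolding hausdorff_measure_eq_0_iff
proof (intro allI impI)
  fix \<delta> :: real assume "\<delta> > 0"
  then have "(\<Sum>n. hausdorff_premeasure s \<delta> (A n)) = 0"
    using assms by (simp add: hausdorff_measure_eq_0_iff)
  then show "hausdorff_premeasure s \<delta> (\<Union>n. A n) = 0"
    using hausdorff_premeasure_UN_le[of s \<delta> A] by simp
qed

text \<open>Hausdorff-Cantelli: every tail of the family of balls still covers \<open>A\<close>,
  while the tails of the convergent series tend to 0.\<close>

lemma hausdorff_measure_limsup_eq_0:
  fixes F :: "nat \<Rightarrow> 'a::real_normed_vector set"
  assumes s: "0 < s" and fin: "\<And>k. finite (F k)" and nn: "\<And>k. 0 \<le> \<rho> k" and lim: "\<rho> \<longlonglongrightarrow> 0"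
    and sum: "summable (\<lambda>k. real (card (F k)) * (2 * \<rho> k) powr s)"
    and A: "\<And>x. x \<in> A \<Longrightarrow> \<exists>\<^sub>\<infinity>k. \<exists>y\<in>F k. dist x y \<le> \<rho> k"
  shows "hausdorff_measure s A = 0"
  unfolding hausdorff_measure_eq_0_iff
proof (intro allI impI)
  fix \<delta> :: real assume \<delta>: "\<delta> > 0"
  let ?f = "\<lambda>k. real (card (F k)) * (2 * \<rho> k) powr s"
  have "hausdorff_premeasure s \<delta> A \<le> ennreal e" if e: "e > 0" for e
  proof -
    have "(\<lambda>n. \<Sum>k. ?f (k + n)) \<longlonglongrightarrow> 0"
      by (rule suminf_exist_split2[OF sum])
    then have "\<forall>\<^sub>F n in sequentially. (\<Sum>k. ?f (k + n)) < e"
      using e by (rule order_tendstoD)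
    then obtain K1 where K1: "\<And>n. n \<ge> K1 \<Longrightarrow> (\<Sum>k. ?f (k + n)) < e"
      by (auto simp: eventually_sequentially)
    have "\<forall>\<^sub>F n in sequentially. \<rho> n < \<delta> / 2"
      using lim \<delta> by (intro order_tendstoD) auto
    then obtain K2 where K2: "\<And>n. n \<ge> K2 \<Longrightarrow> \<rho> n < \<delta> / 2"
      by (auto simp: eventually_sequentially)
    \<comment> \<open>Beyond \<open>K\<close> the tail sum is below \<open>e\<close> and all balls
      have diameter below \<open>\<delta>\<close>, so they form an admissible cover.\<close>
    define K where "K = max K1 K2"
    have "A \<subseteq> (\<Union>k. \<Union>y\<in>F (k + K). cball y (\<rho> (k + K)))"
    proof
      fix x assume "x \<in> A"
      then obtain k where k: "k \<ge> K" "\<exists>y\<in>F k. dist x y \<le> \<rho> k"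
        using A[of x] unfolding INFM_nat_le by blast
      then show "x \<in> (\<Union>k. \<Union>y\<in>F (k + K). cball y (\<rho> (k + K)))"
        by (auto simp: dist_commute intro!: exI[of _ "k - K"])
    qed
    then have "hausdorff_premeasure s \<delta> A \<le> (\<Sum>k. hausdorff_premeasure s \<delta> (\<Union>y\<in>F (k + K). cball y (\<rho> (k + K))))"
      by (rule order_trans[OF hausdorff_premeasure_mono hausdorff_premeasure_UN_le])
    also have "\<dots> \<le> (\<Sum>k. ennreal (?f (k + K)))"
    proof (intro suminf_le summableI)
      fix k
      have *: "hausdorff_premeasure s \<delta> (cball y (\<rho> (k + K))) \<le> ennreal ((2 * \<rho> (k + K)) powr s)" for y :: 'a
      proof -
        have d: "diameter (cball y (\<rho> (k + K))) \<le> 2 * \<rho> (k + K)"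
        proof (rule diameter_le)
          fix a b assume "a \<in> cball y (\<rho> (k + K))" "b \<in> cball y (\<rho> (k + K))"
          then show "norm (a - b) \<le> 2 * \<rho> (k + K)"
            using dist_triangle3[of a b y] by (simp add: dist_norm)
        qed (use nn[of "k+K"] in simp)
        have r: "\<rho> (k + K) < \<delta> / 2"
          by (rule K2) (simp add: K_def)
        have "hausdorff_premeasure s \<delta> (cball y (\<rho> (k + K))) \<le> diam_powr s (cball y (\<rho> (k + K)))"
          using d r \<delta> by (intro hausdorff_premeasure_le_diam_powr) auto
        also have "\<dots> \<le> ennreal ((2 * \<rho> (k + K)) powr s)"
          using s d by (auto simp: diam_powr_def intro!: ennreal_leI powr_mono2 diameter_ge_0)
        finally show ?thesis .
      qed
      have "hausdorff_premeasure s \<delta> (\<Union>y\<in>F (k + K). cball y (\<rho> (k + K)))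
          \<le> (\<Sum>y\<in>F (k + K). hausdorff_premeasure s \<delta> (cball y (\<rho> (k + K))))"
        using fin \<delta> by (intro hausdorff_premeasure_finite_UN_le) auto
      also have "\<dots> \<le> (\<Sum>y\<in>F (k + K). ennreal ((2 * \<rho> (k + K)) powr s))"
        by (intro sum_mono *)
      also have "\<dots> = ennreal (?f (k + K))"
        by (simp add: ennreal_mult ennreal_of_nat_eq_real_of_nat)
      finally show "hausdorff_premeasure s \<delta> (\<Union>y\<in>F (k + K). cball y (\<rho> (k + K))) \<le> ennreal (?f (k + K))" .
    qed
    also have "\<dots> = ennreal (\<Sum>k. ?f (k + K))"
      using sum by (intro suminf_ennreal2) (auto simp: summable_iff_shift[of ?f])
    also have "\<dots> \<le> ennreal e"
      using K1[of K] by (intro ennreal_leI) (auto simp: K_def)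
    finally show ?thesis .
  qed
  then have "hausdorff_premeasure s \<delta> A \<le> 0"
    by - (rule ennreal_le_epsilon, simp)
  then show "hausdorff_premeasure s \<delta> A = 0"
    by simp
qed

section \<open>Ratios of integral quaternions\<close>

text \<open>Subadditivity of Lebesgue measure; the volume of the unit ball is a common factor and
  cancels.\<close>

lemma cover_cball_volume:
  fixes x :: "'a::euclidean_space"
  assumes "finite I" "0 \<le> R" "\<And>i. i \<in> I \<Longrightarrow> 0 \<le> \<rho> i"
    and cover: "cball x R \<subseteq> (\<Union>i\<in>I. cball (c i) (\<rho> i))"
  shows "R ^ DIM('a) \<le> (\<Sum>i\<in>I. \<rho> i ^ DIM('a))"
proof -
  let ?w = "unit_ball_vol (real DIM('a))"
  have "(\<Union>i\<in>I. cball (c i) (\<rho> i)) \<in> lmeasurable"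
    using assms(1) by (intro fmeasurable.finite_UN) auto
  then have "?w * R ^ DIM('a) \<le> measure lebesgue (\<Union>i\<in>I. cball (c i) (\<rho> i))"
    using cover measure_mono_fmeasurable[of "cball x R" "\<Union>i\<in>I. cball (c i) (\<rho> i)" lebesgue] assms(2)
    by (simp add: content_cball)
  also have "\<dots> \<le> (\<Sum>i\<in>I. measure lebesgue (cball (c i) (\<rho> i)))"
    using assms(1) by (intro measure_UNION_le) auto
  also have "\<dots> = ?w * (\<Sum>i\<in>I. \<rho> i ^ DIM('a))"
    using assms(3) by (simp add: content_cball sum_distrib_left)
  finally show ?thesis
    by simp
qed

text \<open>The open balls of radius \<open>\<delta>/2\<close> around the points of \<open>S\<close>
  are disjoint and lie in a ball of radius \<open>R + \<delta>/2\<close>, so their number is at most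
  the quotient of the volumes.\<close>

lemma card_separated_le:
  fixes S :: "'a::euclidean_space set"
  assumes "finite S" "S \<subseteq> cball x R" "0 \<le> R" "0 < \<delta>"
    and sep: "pairwise (\<lambda>y z. \<delta> \<le> dist y z) S"
  shows "real (card S) \<le> (2 * R / \<delta> + 1) ^ DIM('a)"
proof -
  let ?w = "unit_ball_vol (real DIM('a))"
  have "pairwise (\<lambda>y z. disjnt (ball y (\<delta>/2)) (ball z (\<delta>/2))) S"
    using sep unfolding pairwise_def disjnt_def
    by (metis add_divide_distrib disjoint_ballI field_sum_of_halves)
  then have "measure lebesgue (\<Union>y\<in>S. ball y (\<delta>/2)) = (\<Sum>y\<in>S. measure lebesgue (ball y (\<delta>/2)))"
    using assms(1) by (intro measure_UNION') auto
  also have "\<dots> = ?w * (real (card S) * (\<delta>/2) ^ DIM('a))"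
    using \<open>0 < \<delta>\<close> by (simp add: content_ball)
  finally have "?w * (real (card S) * (\<delta>/2) ^ DIM('a)) = measure lebesgue (\<Union>y\<in>S. ball y (\<delta>/2))" ..
  also have "\<dots> \<le> measure lebesgue (cball x (R + \<delta>/2))"
  proof (rule measure_mono_fmeasurable)
    show "(\<Union>y\<in>S. ball y (\<delta>/2)) \<subseteq> cball x (R + \<delta>/2)"
    proof clarsimp
      fix y z assume "y \<in> S" "dist y z * 2 < \<delta>"
      moreover from \<open>y \<in> S\<close> have "dist x y \<le> R" using assms(2) by auto
      ultimately show "dist x z \<le> R + \<delta>/2" using dist_triangle[of x z y] by simp
    qed
    show "(\<Union>y\<in>S. ball y (\<delta>/2)) \<in> sets lebesgue"
      using assms(1) by (intro sets.finite_UN) auto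
  qed auto
  also have "\<dots> = ?w * (R + \<delta>/2) ^ DIM('a)"
    using assms by (simp add: content_cball)
  finally have "real (card S) * (\<delta>/2) ^ DIM('a) \<le> (R + \<delta>/2) ^ DIM('a)"
    by simp
  moreover have "0 < (\<delta>/2) ^ DIM('a)"
    using \<open>0 < \<delta>\<close> by simp
  ultimately have "real (card S) \<le> ((R + \<delta>/2) / (\<delta>/2)) ^ DIM('a)"
    by (simp only: power_divide[of "R + \<delta>/2" "\<delta>/2"] pos_le_divide_eq)
  also have "(R + \<delta>/2) / (\<delta>/2) = 2 * R / \<delta> + 1"
    using \<open>0 < \<delta>\<close> by (simp add: field_simps)
  finally show ?thesis .
qed

text \<open>A separated subset that is maximal under inclusion is a net: a point farther than
  \<open>\<delta>\<close> from all of it could be added.\<close>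

lemma maximal_separated_subset:
  fixes G :: "'a::metric_space set"
  assumes "finite G" "0 \<le> \<delta>"
  obtains S where "S \<subseteq> G" "pairwise (\<lambda>y z. \<delta> \<le> dist y z) S" "G \<subseteq> (\<Union>y\<in>S. cball y \<delta>)"
proof -
  define P where "P = {S. S \<subseteq> G \<and> pairwise (\<lambda>y z. \<delta> \<le> dist y z) S}"
  have "finite P" "{} \<in> P"
    using assms by (auto simp: P_def)
  then have "\<exists>S\<in>P. \<forall>T\<in>P. S \<subseteq> T \<longrightarrow> S = T"
    by (intro finite_has_maximal) auto
  then obtain S where S: "S \<in> P" and max: "\<And>T. T \<in> P \<Longrightarrow> S \<subseteq> T \<Longrightarrow> S = T"
    by blast
  have "\<exists>y\<in>S. dist y z \<le> \<delta>" if "z \<in> G" for z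
  proof (rule ccontr)
    assume *: "\<not> (\<exists>y\<in>S. dist y z \<le> \<delta>)"
    have far: "\<delta> \<le> dist y z" if "y \<in> S" for y
    proof -
      have "\<not> dist y z \<le> \<delta>" using * that by blast
      then show ?thesis by simp
    qed
    then have "insert z S \<in> P"
      using S \<open>z \<in> G\<close> by (auto simp: P_def pairwise_insert dist_commute[of z])
    with max[of "insert z S"] have "z \<in> S" by blast
    with * assms(2) show False by force
  qed
  then show ?thesis
    using S by (intro that[of S]) (auto simp: P_def)
qed

section \<open>Integral quaternions: lattice counts and Dirichlet's theorem\<close>

definition lipschitz_integers :: "quat set" where
  "lipschitz_integers = {x. qRe x \<in> \<int> \<and> qIm1 x \<in> \<int> \<and> qIm2 x \<in> \<int> \<and> qIm3 x \<in> \<int>}"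

lemma lipschitz_integers_diff:
  "x \<in> lipschitz_integers \<Longrightarrow> y \<in> lipschitz_integers \<Longrightarrow> x - y \<in> lipschitz_integers"
  by (simp add: lipschitz_integers_def)

lemma lipschitz_subset_hurwitz: "lipschitz_integers \<subseteq> hurwitz_integers"
  by (auto simp: lipschitz_integers_def hurwitz_integers_def)

lemma abs_component_le_norm:
  "\<bar>qRe x\<bar> \<le> norm x" "\<bar>qIm1 x\<bar> \<le> norm x" "\<bar>qIm2 x\<bar> \<le> norm x" "\<bar>qIm3 x\<bar> \<le> norm x"
  unfolding norm_quat_def by (rule real_le_rsqrt, simp)+

lemma norm_quat_le:
  assumes "\<bar>qRe x\<bar> \<le> t" "\<bar>qIm1 x\<bar> \<le> t" "\<bar>qIm2 x\<bar> \<le> t" "\<bar>qIm3 x\<bar> \<le> t"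
  shows "norm x \<le> 2 * t"
proof -
  have t: "0 \<le> t" using assms by linarith
  have "(qRe x)\<^sup>2 \<le> t\<^sup>2" "(qIm1 x)\<^sup>2 \<le> t\<^sup>2" "(qIm2 x)\<^sup>2 \<le> t\<^sup>2" "(qIm3 x)\<^sup>2 \<le> t\<^sup>2"
    using assms t by (simp_all add: power2_le_iff_abs_le)
  then have "(qRe x)\<^sup>2 + (qIm1 x)\<^sup>2 + (qIm2 x)\<^sup>2 + (qIm3 x)\<^sup>2 \<le> (2 * t)\<^sup>2"
    by simp
  then show ?thesis
    unfolding norm_quat_def using t by (intro real_le_lsqrt) auto
qed

text \<open>The ball lies in a cube of side \<open>2 * T\<close>, and an interval of that length
  contains at most \<open>2 * T + 1\<close> integers.\<close>

lemma lipschitz_integers_cball: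
  assumes "0 \<le> T"
  shows "finite (lipschitz_integers \<inter> cball z T)"
    and "real (card (lipschitz_integers \<inter> cball z T)) \<le> (2 * T + 1) ^ 4"
proof -
  define I where "I a = {\<lceil>a - T\<rceil>..\<lfloor>a + T\<rfloor>}" for a :: real
  define f where "f = (\<lambda>(a :: int, b :: int, c :: int, d :: int). Quat a b c d)"
  define J where "J = I (qRe z) \<times> I (qIm1 z) \<times> I (qIm2 z) \<times> I (qIm3 z)"
  have I: "real (card (I a)) \<le> 2 * T + 1" for a
    unfolding I_def using assms by (simp add: of_nat_nat le_nat_iff) linarith
  have sub: "lipschitz_integers \<inter> cball z T \<subseteq> f ` J"
  proof
    fix x assume x: "x \<in> lipschitz_integers \<inter> cball z T"
    then obtain a b c d :: int where abcd: "qRe x = a" "qIm1 x = b" "qIm2 x = c" "qIm3 x = d"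
      by (auto simp: lipschitz_integers_def elim!: Ints_cases)
    have "norm (x - z) \<le> T"
      using x by (simp add: dist_norm norm_minus_commute)
    then have "a \<in> I (qRe z)" "b \<in> I (qIm1 z)" "c \<in> I (qIm2 z)" "d \<in> I (qIm3 z)"
      using abs_component_le_norm[of "x - z"] abcd
      by (auto simp: I_def ceiling_le_iff le_floor_iff)
    then have "(a, b, c, d) \<in> J" "x = f (a, b, c, d)"
      by (auto simp: J_def f_def abcd quat_eq_iff)
    then show "x \<in> f ` J" by blast
  qed
  have J: "finite J" by (simp add: J_def I_def)
  show "finite (lipschitz_integers \<inter> cball z T)"
    using sub J finite_surj by blast
  have "card (lipschitz_integers \<inter> cball z T) \<le> card J"
    using sub J surj_card_le by blast
  then have "real (card (lipschitz_integers \<inter> cball z T)) \<le> real (card J)"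
    by simp
  also have "\<dots> = real (card (I (qRe z))) * (real (card (I (qIm1 z))) * (real (card (I (qIm2 z))) * real (card (I (qIm3 z)))))"
    by (simp add: J_def card_cartesian_product)
  also have "\<dots> \<le> (2 * T + 1) * ((2 * T + 1) * ((2 * T + 1) * (2 * T + 1)))"
    using assms by (intro mult_mono I) auto
  also have "\<dots> = (2 * T + 1) ^ 4"
    by (simp add: power4_eq_xxxx)
  finally show "real (card (lipschitz_integers \<inter> cball z T)) \<le> (2 * T + 1) ^ 4" .
qed

lemma lipschitz_integers_norm_ge_1:
  assumes "x \<in> lipschitz_integers" "x \<noteq> 0"
  shows "1 \<le> norm x"
proof -
  have "1 \<le> \<bar>qRe x\<bar> \<or> 1 \<le> \<bar>qIm1 x\<bar> \<or> 1 \<le> \<bar>qIm2 x\<bar> \<or> 1 \<le> \<bar>qIm3 x\<bar>"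
    using assms by (auto simp: lipschitz_integers_def quat_eq_iff Ints_nonzero_abs_ge1)
  then show ?thesis
    using abs_component_le_norm[of x] by linarith
qed

primcorec quat_floor :: "quat \<Rightarrow> quat" where
  "qRe (quat_floor x) = \<lfloor>qRe x\<rfloor>"
| "qIm1 (quat_floor x) = \<lfloor>qIm1 x\<rfloor>"
| "qIm2 (quat_floor x) = \<lfloor>qIm2 x\<rfloor>"
| "qIm3 (quat_floor x) = \<lfloor>qIm3 x\<rfloor>"

lemma quat_floor_in [simp]: "quat_floor x \<in> lipschitz_integers"
  by (simp add: lipschitz_integers_def)

lemma norm_diff_quat_floor_le: "norm (x - quat_floor x) \<le> 2"
proof -
  have "\<bar>t - real_of_int \<lfloor>t\<rfloor>\<bar> \<le> 1" for t :: real
    by linarith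
  then show ?thesis
    using norm_quat_le[of "x - quat_floor x" 1] by simp
qed

text \<open>Pigeonhole principle: there are \<open>(M + 1) ^ 4\<close> quaternions
  \<open>g u\<close> with coordinates in \<open>0..M\<close>, but only \<open>M ^ 4\<close> cells of
  side \<open>1 / M\<close> for the fractional parts of \<open>\<xi> * g u\<close>. The difference
  of two that share a cell is the denominator. It multiplies from the right, to match
  \<open>p * inverse q\<close>.\<close>

lemma dirichlet_lipschitz:
  fixes \<xi> :: quat and M :: nat
  assumes M: "M \<ge> 1"
  obtains p q where "p \<in> lipschitz_integers" "q \<in> lipschitz_integers" "q \<noteq> 0"
    "norm q \<le> 2 * real M" "norm (\<xi> * q - p) \<le> 2 / real M"
proof -
  define A where "A = {..M} \<times> {..M} \<times> {..M} \<times> {..M}"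
  define g where "g = (\<lambda>(a :: nat, b :: nat, c :: nat, d :: nat). Quat a b c d)"
  define cell where "cell x = nat \<lfloor>M * frac x\<rfloor>" for x :: real
  define f where "f u = (cell (qRe (\<xi> * g u)), cell (qIm1 (\<xi> * g u)), cell (qIm2 (\<xi> * g u)), cell (qIm3 (\<xi> * g u)))" for u
  have cell_less: "cell x < M" for x
  proof -
    have "M * frac x < M" using M frac_lt_1[of x] by simp
    then show ?thesis using frac_ge_0[of x] M by (simp add: cell_def nat_less_iff floor_less_iff)
  qed
  have cell_eq: "\<bar>frac x - frac y\<bar> \<le> 1 / M" if "cell x = cell y" for x y
  proof -
    have "\<lfloor>M * frac x\<rfloor> = \<lfloor>M * frac y\<rfloor>"
      using that frac_ge_0 by (simp add: cell_def eq_nat_nat_iff)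
    then have "\<bar>M * frac x - M * frac y\<bar> \<le> 1" by linarith
    then have "M * \<bar>frac x - frac y\<bar> \<le> 1" by (simp add: abs_mult flip: right_diff_distrib)
    then show ?thesis using M by (simp add: field_simps)
  qed
  have "f ` A \<subseteq> {..<M} \<times> {..<M} \<times> {..<M} \<times> {..<M}"
    using cell_less by (auto simp: f_def)
  then have "card (f ` A) \<le> card ({..<M} \<times> {..<M} \<times> {..<M} \<times> {..<M})"
    by (intro card_mono) auto
  also have "\<dots> = M ^ 4" by (simp add: card_cartesian_product power4_eq_xxxx)
  also have "\<dots> < (Suc M) ^ 4" by (intro power_strict_mono) auto
  also have "\<dots> = card A" by (simp add: A_def card_cartesian_product power4_eq_xxxx)
  finally have "\<not> inj_on f A" by (rule pigeonhole)
  then obtain u w where uw: "u \<in> A" "w \<in> A" "f u = f w" "u \<noteq> w"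
    unfolding inj_on_def by blast
  define q where "q = g u - g w"
  define p where "p = quat_floor (\<xi> * g u) - quat_floor (\<xi> * g w)"
  show ?thesis
  proof (rule that)
    show "p \<in> lipschitz_integers" by (simp add: p_def lipschitz_integers_diff)
    show "q \<in> lipschitz_integers" unfolding q_def
      by (intro lipschitz_integers_diff) (auto simp: g_def lipschitz_integers_def split: prod.splits)
    show "q \<noteq> 0"
      using uw(4) by (auto simp: q_def g_def quat_eq_iff split: prod.splits)
    show "norm q \<le> 2 * real M"
      using uw(1,2) by (intro norm_quat_le) (auto simp: q_def g_def A_def split: prod.splits)
    have "norm (\<xi> * q - p) \<le> 2 * (1 / M)"
    proof (rule norm_quat_le)
      \<comment> \<open>Coordinatewise this is a difference of two fractional parts from the same
        cell.\<close>
      have *: "\<xi> * q - p = (\<xi> * g u - quat_floor (\<xi> * g u)) - (\<xi> * g w - quat_floor (\<xi> * g w))"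
        by (simp add: q_def p_def right_diff_distrib)
      show "\<bar>qRe (\<xi> * q - p)\<bar> \<le> 1 / M"
        using cell_eq[of "qRe (\<xi> * g u)" "qRe (\<xi> * g w)"] uw(3)
        unfolding * f_def by (simp only: minus_quat.sel quat_floor.sel frac_def prod.inject)
      show "\<bar>qIm1 (\<xi> * q - p)\<bar> \<le> 1 / M"
        using cell_eq[of "qIm1 (\<xi> * g u)" "qIm1 (\<xi> * g w)"] uw(3)
        unfolding * f_def by (simp only: minus_quat.sel quat_floor.sel frac_def prod.inject)
      show "\<bar>qIm2 (\<xi> * q - p)\<bar> \<le> 1 / M"
        using cell_eq[of "qIm2 (\<xi> * g u)" "qIm2 (\<xi> * g w)"] uw(3)
        unfolding * f_def by (simp only: minus_quat.sel quat_floor.sel frac_def prod.inject)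
      show "\<bar>qIm3 (\<xi> * q - p)\<bar> \<le> 1 / M"
        using cell_eq[of "qIm3 (\<xi> * g u)" "qIm3 (\<xi> * g w)"] uw(3)
        unfolding * f_def by (simp only: minus_quat.sel quat_floor.sel frac_def prod.inject)
    qed
    then show "norm (\<xi> * q - p) \<le> 2 / real M" by simp
  qed
qed

section \<open>Many separated ratios with large denominators\<close>

lemma norm_mult_diff_quotient:
  fixes x p q :: "'a::real_normed_div_algebra"
  assumes "q \<noteq> 0"
  shows "norm (x * q - p) = norm (x - p * inverse q) * norm q"
proof -
  have "x * q - p = (x - p * inverse q) * q"
    using assms by (simp add: left_diff_distrib mult.assoc)
  then show ?thesis by (simp add: norm_mult)
qed

text \<open>Dirichlet's theorem covers \<open>cball x (r / 2)\<close>, which needs fourth powers of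
  radii summing to at least \<open>r ^ 4 / 16\<close>. Small denominators supply at most
  \<open>r ^ 4 / 64 + r ^ 4 / 64\<close>, so the balls of radius \<open>81 / M\<^sup>2\<close>
  around \<open>S\<close> supply the remaining \<open>r ^ 4 / 32\<close>, which bounds
  \<open>card S\<close> from below.\<close>

lemma separated_ratios:
  fixes x :: quat and r :: real and M :: nat
  assumes r: "0 < r" "r \<le> 1" and M: "700 / r\<^sup>2 \<le> M"
  obtains S where "finite S" "S \<subseteq> cball x (3 * r / 4)"
    "r ^ 4 * real M ^ 8 / (32 * 81 ^ 4) \<le> card S"
    "pairwise (\<lambda>y z. 1 / (real M)\<^sup>2 \<le> dist y z) S"
    "\<And>y. y \<in> S \<Longrightarrow> \<exists>p\<in>lipschitz_integers. \<exists>q\<in>lipschitz_integers.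
       y = p * inverse q \<and> M / 40 \<le> norm q \<and> norm q \<le> 2 * M"
proof -
  let ?L = lipschitz_integers
  have M700: "700 / r \<le> M" "700 \<le> M" "0 < M" and M2: "320 / r \<le> (real M)\<^sup>2"
  proof -
    have "r\<^sup>2 \<le> r" using r by (simp add: power2_eq_square mult_left_le)
    then have "700 / r \<le> 700 / r\<^sup>2" using r by (intro divide_left_mono) auto
    then show *: "700 / r \<le> M" using M by linarith
    have "700 / 1 \<le> 700 / r" using r by (intro divide_left_mono) auto
    with * have **: "700 \<le> real M" by linarith
    then show "700 \<le> M" "0 < M" by auto
    have "real M * 1 \<le> real M * real M" using ** by (intro mult_left_mono) auto
    moreover have "320 / r \<le> 700 / r" using r by (intro divide_right_mono) auto
    ultimately show "320 / r \<le> (real M)\<^sup>2" using * by (simp add: power2_eq_square)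
  qed
  \<comment> \<open>For \<open>\<xi>\<close> near \<open>x\<close>, the numerators that Dirichlet's theorem pairs with \<open>q\<close> lie in \<open>P q\<close>. The points
    whose Dirichlet denominator has norm below \<open>M / 40\<close> fill at most half of the ball; denominators
    below \<open>5 / r\<close> (\<open>Q1\<close>) are treated apart because there the constant term of \<open>card (P q)\<close> dominates.\<close>
  define P where "P q = ?L \<inter> cball (x * q) (r / 2 * norm q + 2)" for q :: quat
  define c where "c u = snd u * inverse (fst u)" for u :: "quat \<times> quat"
  define \<rho> where "\<rho> u = 2 / (M * norm (fst u))" for u :: "quat \<times> quat"
  have finP: "finite (P q)" and cardP: "card (P q) \<le> (r * norm q + 5) ^ 4" for q
  proof -
    have "0 \<le> r / 2 * norm q + 2" using r by simp
    from lipschitz_integers_cball[OF this, of "x * q"]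
    show "finite (P q)" "card (P q) \<le> (r * norm q + 5) ^ 4"
      by (simp_all add: P_def add.commute)
  qed
  define Q1 where "Q1 = ?L \<inter> cball 0 (5 / r) \<inter> {q. q \<noteq> 0}"
  define Q2 where "Q2 = ?L \<inter> cball 0 (M / 40) \<inter> {q. q \<noteq> 0 \<and> 5 / r \<le> norm q}"
  define Q3 where "Q3 = ?L \<inter> cball 0 (2 * M) \<inter> {q. q \<noteq> 0 \<and> M / 40 \<le> norm q}"
  have finL: "finite (?L \<inter> cball 0 T \<inter> X)" if "0 \<le> T" for T :: real and X
    using lipschitz_integers_cball(1)[OF that] by simp
  have finQ: "finite Q1" "finite Q2" "finite Q3"
    unfolding Q1_def Q2_def Q3_def by (rule finL, use r in simp)+
  have card1: "card Q1 \<le> (11 / r) ^ 4"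
  proof -
    have "real (card Q1) \<le> card (?L \<inter> cball 0 (5 / r))"
      using r by (auto simp: Q1_def intro!: card_mono lipschitz_integers_cball)
    also have "\<dots> \<le> (2 * (5 / r) + 1) ^ 4"
      using r by (intro lipschitz_integers_cball) auto
    also have "\<dots> \<le> (11 / r) ^ 4"
      using r by (intro power_mono) (auto simp: field_simps)
    finally show ?thesis .
  qed
  have card2: "card Q2 \<le> (3 * M / 40) ^ 4"
  proof -
    have "real (card Q2) \<le> card (?L \<inter> cball 0 (M / 40))"
      by (auto simp: Q2_def intro!: card_mono lipschitz_integers_cball)
    also have "\<dots> \<le> (2 * (M / 40) + 1) ^ 4"
      by (intro lipschitz_integers_cball) auto
    also have "\<dots> \<le> (3 * M / 40) ^ 4"
      using M700 by (intro power_mono) auto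
    finally show ?thesis .
  qed
  have norm_ge: "1 \<le> norm q" if "q \<in> Q1 \<union> Q2 \<union> Q3" for q
    using that lipschitz_integers_norm_ge_1[of q] by (auto simp: Q1_def Q2_def Q3_def)
  have sum_Sigma: "(\<Sum>u\<in>Sigma Q P. \<rho> u ^ 4) = (\<Sum>q\<in>Q. card (P q) * (2 / (M * norm q)) ^ 4)"
    if "finite Q" for Q
    using sum.Sigma[of Q P "\<lambda>q p. (2 / (M * norm q)) ^ 4"] finP that
    by (simp add: \<rho>_def case_prod_unfold)
  have sum1: "(\<Sum>u\<in>Sigma Q1 P. \<rho> u ^ 4) \<le> r ^ 4 / 64"
  proof -
    have "(\<Sum>u\<in>Sigma Q1 P. \<rho> u ^ 4) = (\<Sum>q\<in>Q1. card (P q) * (2 / (M * norm q)) ^ 4)"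
      by (rule sum_Sigma) (rule finQ)
    also have "\<dots> \<le> (\<Sum>q\<in>Q1. 10 ^ 4 * (2 / M) ^ 4)"
    proof (intro sum_mono mult_mono)
      fix q assume q: "q \<in> Q1"
      then have "r * norm q + 5 \<le> 10" using r by (auto simp: Q1_def field_simps)
      then have "(r * norm q + 5) ^ 4 \<le> 10 ^ 4" using r by (intro power_mono) auto
      with cardP[of q] show "card (P q) \<le> (10 ^ 4 :: real)" by linarith
      show "(2 / (M * norm q)) ^ 4 \<le> (2 / M) ^ 4"
        using norm_ge[of q] q M700 by (intro power_mono divide_left_mono) (auto simp: mult_le_cancel_left1 intro!: mult_pos_pos)
    qed auto
    also have "\<dots> = card Q1 * (10 ^ 4 * (2 / M) ^ 4)" by simp
    also have "\<dots> \<le> (11 / r) ^ 4 * (10 ^ 4 * (2 / M) ^ 4)"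
      by (intro mult_right_mono card1) auto
    also have "\<dots> = (220 / (r * M)) ^ 4" by (simp add: power_divide power_mult_distrib)
    \<comment> \<open>This is where the lower bound on \<open>M\<close> is quadratic in
      \<open>1 / r\<close>: the constant count for \<open>Q1\<close> leaves a factor
      \<open>1 / (r * M)\<close>, which must be at most a small multiple of
      \<open>r\<close>.\<close>
    also have "\<dots> \<le> (r * (220 / 700)) ^ 4"
    proof (intro power_mono)
      have "700 \<le> r\<^sup>2 * M" using M r by (simp add: field_simps)
      then show "220 / (r * M) \<le> r * (220 / 700)"
        using r M700 by (simp add: field_simps power2_eq_square)
    qed (use r in auto)
    also have "\<dots> \<le> r ^ 4 / 64" using r by (simp add: power_mult_distrib power_divide)
    finally show ?thesis .
  qed
  have sum2: "(\<Sum>u\<in>Sigma Q2 P. \<rho> u ^ 4) \<le> r ^ 4 / 64"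
  proof -
    have "(\<Sum>u\<in>Sigma Q2 P. \<rho> u ^ 4) = (\<Sum>q\<in>Q2. card (P q) * (2 / (M * norm q)) ^ 4)"
      by (rule sum_Sigma) (rule finQ)
    \<comment> \<open>For \<open>5 \<le> r * norm q\<close> the number of numerators is at most
      \<open>(2 * r * norm q) ^ 4\<close>, so \<open>norm q\<close> cancels against the radius. The
      threshold \<open>M / 40\<close> keeps the resulting factor at \<open>(3 / 10) ^ 4\<close>,
      below \<open>1 / 64\<close>.\<close>
    also have "\<dots> \<le> (\<Sum>q\<in>Q2. (4 * r / M) ^ 4)"
    proof (intro sum_mono)
      fix q assume q: "q \<in> Q2"
      then have q0: "norm q > 0" and "5 \<le> r * norm q" using r by (auto simp: Q2_def field_simps)
      then have "(r * norm q + 5) ^ 4 \<le> (2 * r * norm q) ^ 4" using r by (intro power_mono) auto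
      with cardP[of q] have "card (P q) \<le> (2 * r * norm q) ^ 4" by linarith
      then have "card (P q) * (2 / (M * norm q)) ^ 4 \<le> (2 * r * norm q) ^ 4 * (2 / (M * norm q)) ^ 4"
        by (intro mult_right_mono) auto
      also have "\<dots> = (4 * r / M) ^ 4"
        using q0 by (simp add: power_mult_distrib[symmetric])
      finally show "card (P q) * (2 / (M * norm q)) ^ 4 \<le> (4 * r / M) ^ 4" .
    qed
    also have "\<dots> = card Q2 * (4 * r / M) ^ 4" by simp
    also have "\<dots> \<le> (3 * M / 40) ^ 4 * (4 * r / M) ^ 4"
      by (intro mult_right_mono card2) auto
    also have "\<dots> = (3 / 10 * r) ^ 4"
      using M700 by (simp add: power_mult_distrib[symmetric])
    also have "\<dots> \<le> r ^ 4 / 64" using r by (simp add: power_mult_distrib power_divide)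
    finally show ?thesis .
  qed
  \<comment> \<open>A point within \<open>r / 2\<close> of \<open>x\<close> is at most
    \<open>80 / M\<^sup>2 \<le> r / 4\<close> away from its ratio, hence the radius
    \<open>3 * r / 4\<close>. The last quarter of \<open>r\<close> leaves room for balls around the
    ratios.\<close>
  define G where "G = c ` Sigma Q3 P \<inter> cball x (3 * r / 4)"
  have "finite G" using finQ finP by (auto simp: G_def)
  then obtain S where S: "S \<subseteq> G" "pairwise (\<lambda>y z. 1 / (real M)\<^sup>2 \<le> dist y z) S"
      "G \<subseteq> (\<Union>y\<in>S. cball y (1 / (real M)\<^sup>2))"
    by (rule maximal_separated_subset[of G "1 / (real M)\<^sup>2"]) auto
  have finS: "finite S" using S(1) \<open>finite G\<close> finite_subset by blast
  \<comment> \<open>The 81 is 80 + 1: a denominator of norm at least \<open>M / 40\<close> gives an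
    error of at most \<open>80 / M\<^sup>2\<close>, and the nearest point of the net
    \<open>S\<close> is within \<open>1 / M\<^sup>2\<close>.\<close>
  have cover: "cball x (r / 2) \<subseteq> (\<Union>u\<in>Sigma Q1 P. cball (c u) (\<rho> u)) \<union>
      (\<Union>u\<in>Sigma Q2 P. cball (c u) (\<rho> u)) \<union> (\<Union>y\<in>S. cball y (81 / (real M)\<^sup>2))"
  proof
    fix \<xi> assume \<xi>: "\<xi> \<in> cball x (r / 2)"
    obtain p q where pq: "p \<in> ?L" "q \<in> ?L" "q \<noteq> 0" "norm q \<le> 2 * M" "norm (\<xi> * q - p) \<le> 2 / M"
      using dirichlet_lipschitz[of M \<xi>] M700 by auto
    have q1: "1 \<le> norm q" using pq lipschitz_integers_norm_ge_1 by blast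
    have d: "dist \<xi> (p * inverse q) \<le> 2 / (M * norm q)"
    proof -
      have "0 < M * norm q" using q1 M700 by (intro mult_pos_pos) auto
      moreover have "norm (\<xi> - p * inverse q) * norm q * M \<le> 2"
        using pq(5) M700 unfolding norm_mult_diff_quotient[OF pq(3)] by (simp add: pos_le_divide_eq)
      ultimately show ?thesis
        by (simp add: dist_norm pos_le_divide_eq mult_ac)
    qed
    have p: "p \<in> P q"
    proof -
      have "norm (x * q - p) \<le> norm ((x - \<xi>) * q) + norm (\<xi> * q - p)"
        using norm_triangle_ineq[of "(x - \<xi>) * q" "\<xi> * q - p"] by (simp add: left_diff_distrib)
      also have "\<dots> \<le> r / 2 * norm q + 2"
      proof (intro add_mono)
        show "norm ((x - \<xi>) * q) \<le> r / 2 * norm q"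
          unfolding norm_mult using \<xi> by (intro mult_right_mono) (auto simp: dist_norm)
        have "2 / real M \<le> 2" using M700 by (simp add: divide_le_eq)
        then show "norm (\<xi> * q - p) \<le> 2" using pq(5) by linarith
      qed
      finally show ?thesis using pq(1) by (simp add: P_def dist_norm)
    qed
    consider "norm q \<le> 5 / r" | "5 / r \<le> norm q" "norm q \<le> M / 40" | "M / 40 \<le> norm q"
      by linarith
    then show "\<xi> \<in> (\<Union>u\<in>Sigma Q1 P. cball (c u) (\<rho> u)) \<union>
      (\<Union>u\<in>Sigma Q2 P. cball (c u) (\<rho> u)) \<union> (\<Union>y\<in>S. cball y (81 / (real M)\<^sup>2))"
    proof cases
      case 1
      then have "(q, p) \<in> Sigma Q1 P" using pq p by (auto simp: Q1_def)
      moreover have "\<xi> \<in> cball (c (q, p)) (\<rho> (q, p))" using d by (simp add: c_def \<rho>_def dist_commute)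
      ultimately show ?thesis by blast
    next
      case 2
      then have "(q, p) \<in> Sigma Q2 P" using pq p by (auto simp: Q2_def)
      moreover have "\<xi> \<in> cball (c (q, p)) (\<rho> (q, p))" using d by (simp add: c_def \<rho>_def dist_commute)
      ultimately show ?thesis by blast
    next
      case 3
      then have in3: "(q, p) \<in> Sigma Q3 P" using pq p by (auto simp: Q3_def)
      have "2 / (M * norm q) \<le> 2 / (M * (M / 40))"
        using 3 q1 M700 by (intro divide_left_mono mult_left_mono mult_pos_pos) (auto simp del: zero_less_norm_iff)
      also have "\<dots> = 80 / (real M)\<^sup>2" by (simp add: power2_eq_square)
      finally have d80: "dist \<xi> (p * inverse q) \<le> 80 / (real M)\<^sup>2" using d by linarith
      have "80 / (real M)\<^sup>2 \<le> r / 4"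
        using M2 r M700 by (simp add: field_simps)
      then have "dist x (p * inverse q) \<le> 3 * r / 4"
        using d80 \<xi> dist_triangle[of x "p * inverse q" \<xi>] by simp
      moreover have "p * inverse q \<in> c ` Sigma Q3 P"
        using in3 by (force simp: c_def)
      ultimately have "p * inverse q \<in> G" by (simp add: G_def)
      then obtain y where "y \<in> S" "dist y (p * inverse q) \<le> 1 / (real M)\<^sup>2"
        using S(3) by auto
      moreover have "dist y \<xi> \<le> dist y (p * inverse q) + dist \<xi> (p * inverse q)"
        by (rule dist_triangle2)
      moreover have "1 / (real M)\<^sup>2 + 80 / (real M)\<^sup>2 = 81 / (real M)\<^sup>2"
        by (simp add: add_divide_distrib[symmetric])
      ultimately have "\<xi> \<in> cball y (81 / (real M)\<^sup>2)" using d80 by simp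
      then show ?thesis using \<open>y \<in> S\<close> by blast
    qed
  qed
  \<comment> \<open>The sum type lets one volume comparison handle balls indexed by pairs and balls
    indexed by points of \<open>S\<close>.\<close>
  define I where "I = (Inl ` (Sigma Q1 P \<union> Sigma Q2 P) \<union> Inr ` S :: ((quat \<times> quat) + quat) set)"
  have "(r / 2) ^ DIM(quat) \<le> (\<Sum>i\<in>I. (case_sum \<rho> (\<lambda>_. 81 / (real M)\<^sup>2) i) ^ DIM(quat))"
  proof (rule cover_cball_volume)
    show "finite I" using finQ finP finS by (auto simp: I_def)
    show "0 \<le> r / 2" using r by simp
    show "0 \<le> case_sum \<rho> (\<lambda>_. 81 / (real M)\<^sup>2) i" for i by (simp add: \<rho>_def split: sum.split)
    show "cball x (r / 2) \<subseteq> (\<Union>i\<in>I. cball (case_sum c id i) (case_sum \<rho> (\<lambda>_. 81 / (real M)\<^sup>2) i))"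
      using cover by (simp add: I_def image_Un Un_assoc)
  qed
  also have "\<dots> = (\<Sum>u\<in>Sigma Q1 P \<union> Sigma Q2 P. \<rho> u ^ 4) + card S * (81 / (real M)\<^sup>2) ^ 4"
    unfolding I_def using finQ finP finS
    by (subst sum.union_disjoint) (auto simp: sum.reindex)
  also have "(\<Sum>u\<in>Sigma Q1 P \<union> Sigma Q2 P. \<rho> u ^ 4) \<le> (\<Sum>u\<in>Sigma Q1 P. \<rho> u ^ 4) + (\<Sum>u\<in>Sigma Q2 P. \<rho> u ^ 4)"
    using finQ finP by (subst sum_Un) (auto intro!: sum_nonneg simp: \<rho>_def)
  finally have "(r / 2) ^ 4 \<le> r ^ 4 / 32 + card S * (81 / (real M)\<^sup>2) ^ 4"
    using sum1 sum2 by simp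
  then have "r ^ 4 / 32 \<le> card S * (81 / (real M)\<^sup>2) ^ 4"
    by (simp add: power_divide)
  also have "\<dots> = card S * 81 ^ 4 / real M ^ 8"
    by (simp add: power_divide flip: power_mult)
  finally have "r ^ 4 * real M ^ 8 / (32 * 81 ^ 4) \<le> card S"
    using M700 by (simp add: field_simps)
  moreover have "\<exists>p\<in>?L. \<exists>q\<in>?L. y = p * inverse q \<and> M / 40 \<le> norm q \<and> norm q \<le> 2 * M"
    if "y \<in> S" for y
  proof -
    from that S(1) obtain q p where "q \<in> Q3" "p \<in> P q" "y = p * inverse q"
      by (auto simp: G_def c_def)
    then show ?thesis
      by (intro bexI[of _ p] bexI[of _ q]) (auto simp: Q3_def P_def)
  qed
  ultimately show ?thesis
    using finS S(1,2) by (intro that[of S]) (auto simp: G_def)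
qed

section \<open>Lower bound\<close>

text \<open>
  A cover is beaten directly, without a mass distribution: \<open>U n\<close> is a covering set of size \<open>d n\<close>, and a
  ball of radius \<open>r\<close> is light if the covering sets meeting it are smaller than \<open>r\<close> and have total
  weight at most \<open>\<epsilon> * r powr s\<close>.
\<close>

locale light_cover =
  fixes U :: "nat \<Rightarrow> quat set" and d :: "nat \<Rightarrow> real" and s v :: real
  assumes s_pos: "0 < s" and v_gt_2: "2 < v" and sv_less: "s * v < 8"
    and d_pos: "\<And>n. 0 < d n" and diam: "\<And>n a b. a \<in> U n \<Longrightarrow> b \<in> U n \<Longrightarrow> dist a b \<le> d n"
    and d_summable: "summable (\<lambda>n. d n powr s)"
begin

definition weight :: "quat set \<Rightarrow> real" where
  "weight B = (\<Sum>n. if U n \<inter> B = {} then 0 else d n powr s)"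

text \<open>The factor \<open>1 / (32 * 81 ^ 4)\<close> is the density of ratios in
  \<open>separated_ratios\<close>. Dividing it by \<open>16 * 1297\<close> ensures that large
  covering sets spoil at most half of the children: 8 and 1296 come from
  \<open>card_meeting_le\<close>, and 1297 is 1296 + 1.\<close>

definition \<epsilon> :: real where "\<epsilon> = 1 / (32 * 81 ^ 4) / (16 * 1297)"

definition light :: "quat \<Rightarrow> real \<Rightarrow> bool" where
  "light x r \<longleftrightarrow> (\<forall>n. U n \<inter> cball x r \<noteq> {} \<longrightarrow> d n < r) \<and> weight (cball x r) \<le> \<epsilon> * r powr s"

section \<open>Counting and weight estimates for a fixed cover\<close>

lemma summable_weight: "summable (\<lambda>n. if U n \<inter> B = {} then 0 else d n powr s)"
  by (rule summable_comparison_test'[OF d_summable, of 0]) auto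

lemma weight_le_suminf: "weight B \<le> (\<Sum>n. d n powr s)"
  unfolding weight_def by (intro suminf_le summable_weight d_summable) auto

lemma finite_large: "0 < \<rho> \<Longrightarrow> finite {n. \<rho> \<le> d n}"
proof -
  assume "0 < \<rho>"
  then have "\<forall>\<^sub>F n in sequentially. d n powr s < \<rho> powr s"
    using summable_LIMSEQ_zero[OF d_summable] by (intro order_tendstoD) auto
  then obtain N where N: "\<And>n. N \<le> n \<Longrightarrow> d n powr s < \<rho> powr s"
    by (auto simp: eventually_sequentially)
  have "{n. \<rho> \<le> d n} \<subseteq> {..<N}"
  proof
    fix n assume "n \<in> {n. \<rho> \<le> d n}"
    then have "\<rho> powr s \<le> d n powr s" using s_pos \<open>0 < \<rho>\<close> by (auto intro: powr_mono2)
    with N[of n] show "n \<in> {..<N}" by (meson lessThan_iff not_le)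
  qed
  then show ?thesis using finite_subset by blast
qed

text \<open>The quotient of the two sides is a constant times \<open>M powr (s * v - 8)\<close>,
  which tends to 0. The inner \<open>(2 * M) powr (- v) / 2\<close> is the radius of the children in
  \<open>light_child\<close>.\<close>

lemma eventually_scale:
  assumes "0 < r"
  shows "\<forall>\<^sub>F M in sequentially. r powr s * (((2 * real M) powr (- v)) / 2) powr (- s)
    \<le> 1 / (32 * 81 ^ 4) / 4 * (r ^ 4 * real M ^ 8)"
proof -
  define K where "K = r powr s * 2 powr s * 2 powr (s * v)"
  define L where "L = 1 / (32 * 81 ^ 4) / 4 * r ^ 4"
  have KL: "0 < K" "0 < L" using assms by (auto simp: K_def L_def)
  have "(\<lambda>M. real M powr (s * v - 8)) \<longlonglongrightarrow> 0"
    using sv_less by (intro tendsto_neg_powr filterlim_real_sequentially) auto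
  then have "\<forall>\<^sub>F M in sequentially. real M powr (s * v - 8) < L / K"
    using KL by (intro order_tendstoD) auto
  then show ?thesis
    using eventually_gt_at_top[of 0]
  proof eventually_elim
    fix M :: nat assume M: "real M powr (s * v - 8) < L / K" "0 < M"
    have "r powr s * (((2 * real M) powr (- v)) / 2) powr (- s) = K * real M powr (s * v)"
      using M(2) by (simp add: K_def powr_divide powr_powr powr_mult powr_minus_divide mult_ac)
    also have "real M powr (s * v) = real M powr (s * v - 8) * real M ^ 8"
      using M(2) by (simp add: powr_diff powr_numeral)
    also have "K * \<dots> \<le> L * real M ^ 8"
      using M KL by (simp add: field_simps)
    finally show "r powr s * (((2 * real M) powr (- v)) / 2) powr (- s)
      \<le> 1 / (32 * 81 ^ 4) / 4 * (r ^ 4 * real M ^ 8)"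
      by (simp add: L_def)
  qed
qed

text \<open>Two centres whose balls meet \<open>U n\<close> are at distance at most
  \<open>\<rho> + d n + \<rho> \<le> 3 * d n\<close>, so \<open>card_separated_le\<close> gives
  \<open>(6 * d n * M\<^sup>2 + 1) ^ 4\<close>. Convexity of the fourth power splits this into the
  two terms, with \<open>1296 = 6 ^ 4\<close>.\<close>

lemma card_meeting_le:
  assumes S: "finite S" "pairwise (\<lambda>y z. 1 / (real M)\<^sup>2 \<le> dist y z) S" and "0 < M" and \<rho>: "\<rho> \<le> d n"
  shows "real (card {y \<in> S. U n \<inter> cball y \<rho> \<noteq> {}}) \<le> 8 * (1296 * d n ^ 4 * real M ^ 8 + 1)"
    (is "real (card ?K) \<le> _")
proof (cases "?K = {}")
  case True
  then have "real (card ?K) = 0" by (metis card.empty of_nat_0)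
  then show ?thesis using less_imp_le[OF d_pos[of n]] by simp
next
  case False
  then obtain y a where y: "y \<in> S" "a \<in> U n" "dist y a \<le> \<rho>" by auto
  have "?K \<subseteq> cball y (3 * d n)"
  proof
    fix z assume "z \<in> ?K"
    then obtain b where "b \<in> U n" "b \<in> cball z \<rho>" by auto
    then have "dist z b \<le> \<rho>" "dist a b \<le> d n" using diam y by auto
    moreover have "dist y z \<le> dist y a + (dist a b + dist z b)"
      using dist_triangle[of y z a] dist_triangle2[of a z b] by linarith
    ultimately have "dist y z \<le> 3 * d n" using y \<rho> by linarith
    then show "z \<in> cball y (3 * d n)" by simp
  qed
  moreover have "pairwise (\<lambda>y z. 1 / (real M)\<^sup>2 \<le> dist y z) ?K"
    by (rule pairwise_subset[OF S(2)]) auto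
  ultimately have "real (card ?K) \<le> (2 * (3 * d n) / (1 / (real M)\<^sup>2) + 1) ^ DIM(quat)"
    using S(1) d_pos[of n] \<open>0 < M\<close> by (intro card_separated_le[where x = y]) auto
  also have "\<dots> = (6 * d n * (real M)\<^sup>2 + 1) ^ 4" by simp
  also have "\<dots> \<le> 8 * ((6 * d n * (real M)\<^sup>2) ^ 4 + 1 ^ 4)"
  proof -
    have "(a + b) ^ 4 \<le> 8 * (a ^ 4 + b ^ 4)" for a b :: real
    proof -
      have sq: "(a + b)\<^sup>2 \<le> 2 * (a\<^sup>2 + b\<^sup>2)" for a b :: real
        using sum_squares_ge_zero[of "a - b" 0] by (simp add: power2_eq_square algebra_simps)
      have "(a + b) ^ 4 = ((a + b)\<^sup>2)\<^sup>2"
        by (simp flip: power_mult)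
      also have "\<dots> \<le> (2 * (a\<^sup>2 + b\<^sup>2))\<^sup>2"
        by (rule power_mono[OF sq]) simp
      also have "\<dots> = 4 * (a\<^sup>2 + b\<^sup>2)\<^sup>2"
        by (simp only: power_mult_distrib) simp
      also have "\<dots> \<le> 4 * (2 * ((a\<^sup>2)\<^sup>2 + (b\<^sup>2)\<^sup>2))"
        by (intro mult_left_mono sq) simp
      also have "\<dots> = 8 * (a ^ 4 + b ^ 4)"
        by (simp flip: power_mult)
      finally show ?thesis .
    qed
    then show ?thesis by blast
  qed
  also have "\<dots> = 8 * (1296 * d n ^ 4 * real M ^ 8 + 1)"
    by (simp add: power_mult_distrib flip: power_mult)
  finally show ?thesis .
qed

text \<open>A covering set of size below \<open>\<rho>\<close> cannot meet two balls of radius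
  \<open>\<rho>\<close> whose centres are more than \<open>3 * \<rho>\<close> apart, so each term of
  the series is counted at most once.\<close>

lemma sum_weight_le:
  assumes S: "finite S" "pairwise (\<lambda>y z. 3 * \<rho> < dist y z) S"
    and sub: "\<And>y. y \<in> S \<Longrightarrow> cball y \<rho> \<subseteq> B"
    and small: "\<And>y n. y \<in> S \<Longrightarrow> U n \<inter> cball y \<rho> \<noteq> {} \<Longrightarrow> d n < \<rho>"
  shows "(\<Sum>y\<in>S. weight (cball y \<rho>)) \<le> weight B"
proof -
  have "(\<Sum>y\<in>S. weight (cball y \<rho>)) = (\<Sum>n. \<Sum>y\<in>S. if U n \<inter> cball y \<rho> = {} then 0 else d n powr s)"
    unfolding weight_def by (rule suminf_sum[symmetric]) (rule summable_weight)
  also have "\<dots> \<le> weight B"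
    unfolding weight_def
  proof (rule suminf_le)
    show "summable (\<lambda>n. \<Sum>y\<in>S. if U n \<inter> cball y \<rho> = {} then 0 else d n powr s)"
      by (intro summable_sum summable_weight)
    show "summable (\<lambda>n. if U n \<inter> B = {} then 0 else d n powr s)"
      by (rule summable_weight)
    fix n
    show "(\<Sum>y\<in>S. if U n \<inter> cball y \<rho> = {} then 0 else d n powr s) \<le> (if U n \<inter> B = {} then 0 else d n powr s)"
    proof (cases "\<exists>y\<in>S. U n \<inter> cball y \<rho> \<noteq> {}")
      case False
      then show ?thesis by (auto intro!: sum_nonpos)
    next
      case True
      then obtain y a where y: "y \<in> S" "a \<in> U n" "dist y a \<le> \<rho>" by auto
      then have dn: "d n < \<rho>" by (intro small[of y n]) auto
      have "U n \<inter> cball z \<rho> = {}" if "z \<in> S" "z \<noteq> y" for z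
      proof (rule ccontr)
        assume "U n \<inter> cball z \<rho> \<noteq> {}"
        then obtain b where "b \<in> U n" "dist z b \<le> \<rho>" by auto
        moreover have "3 * \<rho> < dist y z" using S(2) that y by (auto simp: pairwise_def)
        ultimately show False
          using diam[of a n b] y dn dist_triangle[of y z a] dist_triangle2[of a z b] by linarith
      qed
      then have "(\<Sum>z\<in>S. if U n \<inter> cball z \<rho> = {} then 0 else d n powr s) = (\<Sum>z\<in>{y}. d n powr s)"
        using S(1) y by (intro sum.mono_neutral_cong_right) auto
      moreover have "U n \<inter> B \<noteq> {}" using sub[of y] y by auto
      ultimately show ?thesis by simp
    qed
  qed
  finally show ?thesis .
qed

text \<open>
  Few children are met by a covering set of size at least \<open>\<rho>\<close>; each smaller one meets at most one
  child, so some remaining child carries at most the average weight. Since \<open>s * v < 8\<close>, the number of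
  children (of order \<open>r ^ 4 * M ^ 8\<close>) dominates \<open>(r / \<rho>) powr s\<close>.
\<close>

lemma light_child:
  assumes r: "0 < r" "r \<le> 1" and light: "light x r"
  obtains y \<rho> p q where "0 < \<rho>" "\<rho> \<le> r / 2" "cball y \<rho> \<subseteq> cball x r" "light y \<rho>"
    "p \<in> lipschitz_integers" "q \<in> lipschitz_integers" "q \<noteq> 0" "N \<le> norm q"
    "\<And>\<xi>. \<xi> \<in> cball y \<rho> \<Longrightarrow> norm (\<xi> - p * inverse q) < norm q powr (- v)"
proof -
  define c :: real where "c = 1 / (32 * 81 ^ 4)"
  obtain m where m: "\<And>M. M \<ge> m \<Longrightarrow> r powr s * (((2 * real M) powr (- v)) / 2) powr (- s)
    \<le> c / 4 * (r ^ 4 * real M ^ 8)"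
    using eventually_scale[OF r(1)] by (auto simp: eventually_sequentially c_def)
  \<comment> \<open>Large enough for the asymptotic estimate, for \<open>separated_ratios\<close>,
    and for denominators of norm at least \<open>M / 40\<close> to reach both \<open>N\<close> and
    1.\<close>
  define M where "M = max m (nat \<lceil>max (700 / r\<^sup>2) (40 * max N 1)\<rceil>)"
  have M: "700 / r\<^sup>2 \<le> M" "40 * N \<le> M" "40 \<le> M"
    unfolding M_def by linarith+
  \<comment> \<open>All denominators have norm at most \<open>2 * M\<close>, so this radius fits
    every ratio; halving it makes the approximation strict on the closed ball.\<close>
  define \<rho> where "\<rho> = (2 * real M) powr (- v) / 2"
  have scale: "r powr s * \<rho> powr (- s) \<le> c / 4 * (r ^ 4 * real M ^ 8)"
    unfolding \<rho>_def by (rule m) (simp add: M_def)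
  have \<rho>0: "0 < \<rho>" using M by (simp add: \<rho>_def)
  \<comment> \<open>Since \<open>v > 2\<close>, the children are small compared with the spacing
    \<open>1 / M\<^sup>2\<close> of their centres, as \<open>sum_weight_le\<close> requires.\<close>
  have \<rho>M: "\<rho> \<le> 1 / (8 * (real M)\<^sup>2)"
  proof -
    have "(2 * real M) powr (- v) \<le> (2 * real M) powr (- 2)"
      using M v_gt_2 by (intro powr_mono) auto
    also have "\<dots> = 1 / (4 * (real M)\<^sup>2)"
      using M by (simp add: powr_minus_divide power_mult_distrib powr_numeral)
    finally show ?thesis by (simp add: \<rho>_def)
  qed
  have \<rho>r: "\<rho> \<le> r / 4"
  proof -
    have "1 / (8 * (real M)\<^sup>2) \<le> 1 / real M"
      using M by (simp add: field_simps power2_eq_square)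
    also have "1 / real M \<le> r\<^sup>2 / 700"
      using M r by (simp add: field_simps)
    also have "\<dots> \<le> r / 4"
      using r by (simp add: power2_eq_square field_simps) 
    finally show ?thesis using \<rho>M by linarith
  qed
  obtain S where S: "finite S" "S \<subseteq> cball x (3 * r / 4)" "c * (r ^ 4 * real M ^ 8) \<le> card S"
    "pairwise (\<lambda>y z. 1 / (real M)\<^sup>2 \<le> dist y z) S"
    "\<And>y. y \<in> S \<Longrightarrow> \<exists>p\<in>lipschitz_integers. \<exists>q\<in>lipschitz_integers.
       y = p * inverse q \<and> M / 40 \<le> norm q \<and> norm q \<le> 2 * M"
    using separated_ratios[OF r M(1), of x] by (auto simp: c_def)
  have child_sub: "cball y \<rho> \<subseteq> cball x r" if "y \<in> S" for y
  proof
    fix z assume "z \<in> cball y \<rho>"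
    moreover have "dist x y \<le> 3 * r / 4" using that S(2) by auto
    ultimately show "z \<in> cball x r" using dist_triangle[of x z y] \<rho>r by simp
  qed
  define A where "A = {n. \<rho> \<le> d n \<and> U n \<inter> cball x r \<noteq> {}}"
  define K where "K n = {y \<in> S. U n \<inter> cball y \<rho> \<noteq> {}}" for n
  have finA: "finite A"
    using finite_large[OF \<rho>0] by (rule rev_finite_subset) (auto simp: A_def)
  have sumA: "(\<Sum>n\<in>A. d n powr s) \<le> \<epsilon> * r powr s"
  proof -
    have "(\<Sum>n\<in>A. d n powr s) = (\<Sum>n\<in>A. if U n \<inter> cball x r = {} then 0 else d n powr s)"
      by (intro sum.cong) (auto simp: A_def)
    also have "\<dots> \<le> weight (cball x r)"
      unfolding weight_def by (intro sum_le_suminf summable_weight finA) auto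
    finally show ?thesis using light by (simp add: light_def)
  qed
  have "card (\<Union>n\<in>A. K n) \<le> (\<Sum>n\<in>A. card (K n))"
    using finA by (rule card_UN_le)
  then have "real (card (\<Union>n\<in>A. K n)) \<le> (\<Sum>n\<in>A. real (card (K n)))"
    by (metis of_nat_le_iff of_nat_sum)
  \<comment> \<open>Both terms of the count become multiples of \<open>d n powr s\<close>, so that
    the weight of the parent bounds the sum: \<open>d n \<le> r\<close> and \<open>s < 4\<close>
    turn \<open>d n ^ 4\<close> into \<open>d n powr s * r powr (4 - s)\<close>, and
    \<open>\<rho> \<le> d n\<close> gives
    \<open>1 \<le> d n powr s * \<rho> powr (- s)\<close>.\<close>
  also have "\<dots> \<le> (\<Sum>n\<in>A. d n powr s * (8 * (1296 * r powr (4 - s) * real M ^ 8 + \<rho> powr (- s))))"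
  proof (rule sum_mono)
    fix n assume n: "n \<in> A"
    then have dn: "\<rho> \<le> d n" "d n \<le> r" using light by (auto simp: A_def light_def intro: less_imp_le)
    have "s * 2 < s * v" using s_pos v_gt_2 by simp
    then have s4: "s < 4" using sv_less by linarith
    have "d n ^ 4 = d n powr s * d n powr (4 - s)"
      using d_pos[of n] by (simp add: powr_numeral flip: powr_add)
    also have "\<dots> \<le> d n powr s * r powr (4 - s)"
      using dn d_pos[of n] s4 by (intro mult_left_mono powr_mono2) auto
    finally have d4: "d n ^ 4 \<le> d n powr s * r powr (4 - s)" .
    have "\<rho> powr s \<le> d n powr s" using dn \<rho>0 s_pos by (intro powr_mono2) auto
    then have one: "1 \<le> d n powr s * \<rho> powr (- s)"
      using \<rho>0 by (simp add: powr_minus_divide)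
    have "real (card (K n)) \<le> 8 * (1296 * d n ^ 4 * real M ^ 8 + 1)"
      unfolding K_def using S(1,4) M dn by (intro card_meeting_le) auto
    also have "\<dots> \<le> 8 * (1296 * (d n powr s * r powr (4 - s)) * real M ^ 8 + d n powr s * \<rho> powr (- s))"
      using d4 one by (intro mult_left_mono add_mono mult_right_mono) auto
    also have "\<dots> = d n powr s * (8 * (1296 * r powr (4 - s) * real M ^ 8 + \<rho> powr (- s)))"
      by (simp add: algebra_simps)
    finally show "real (card (K n)) \<le> d n powr s * (8 * (1296 * r powr (4 - s) * real M ^ 8 + \<rho> powr (- s)))" .
  qed
  also have "\<dots> = (\<Sum>n\<in>A. d n powr s) * (8 * (1296 * r powr (4 - s) * real M ^ 8 + \<rho> powr (- s)))"
    by (rule sum_distrib_right[symmetric])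
  also have "\<dots> \<le> \<epsilon> * r powr s * (8 * (1296 * r powr (4 - s) * real M ^ 8 + \<rho> powr (- s)))"
    by (intro mult_right_mono sumA) auto
  also have "\<dots> = \<epsilon> * 8 * (1296 * (r powr s * r powr (4 - s)) * real M ^ 8 + r powr s * \<rho> powr (- s))"
    by (simp add: algebra_simps)
  also have "r powr s * r powr (4 - s) = r ^ 4"
    using r by (simp add: powr_numeral flip: powr_add)
  also have "\<epsilon> * 8 * (1296 * r ^ 4 * real M ^ 8 + r powr s * \<rho> powr (- s))
      \<le> \<epsilon> * 8 * (1297 * (r ^ 4 * real M ^ 8))"
  proof (intro mult_left_mono)
    have "c / 4 * (r ^ 4 * real M ^ 8) \<le> 1 * (r ^ 4 * real M ^ 8)"
      using r by (intro mult_right_mono) (auto simp: c_def)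
    then show "1296 * r ^ 4 * real M ^ 8 + r powr s * \<rho> powr (- s) \<le> 1297 * (r ^ 4 * real M ^ 8)"
      using scale by linarith
  qed (auto simp: \<epsilon>_def)
  also have "\<dots> = c / 2 * (r ^ 4 * real M ^ 8)" by (simp add: \<epsilon>_def c_def)
  finally have cardK: "real (card (\<Union>n\<in>A. K n)) \<le> c / 2 * (r ^ 4 * real M ^ 8)" .
  define T where "T = S - (\<Union>n\<in>A. K n)"
  have finT: "finite T" and TS: "T \<subseteq> S" using S(1) by (auto simp: T_def)
  have "real (card S) \<le> real (card T) + real (card (\<Union>n\<in>A. K n))"
  proof -
    have "card S \<le> card (T \<union> (\<Union>n\<in>A. K n))"
      using S(1) finA by (intro card_mono) (auto simp: T_def K_def)
    also have "\<dots> \<le> card T + card (\<Union>n\<in>A. K n)" by (rule card_Un_le)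
    finally show ?thesis by linarith
  qed
  then have cardT: "c / 2 * (r ^ 4 * real M ^ 8) \<le> card T"
    using S(3) cardK by (simp add: field_simps)
  have small: "d n < \<rho>" if "y \<in> T" "U n \<inter> cball y \<rho> \<noteq> {}" for y n
  proof (rule ccontr)
    assume "\<not> d n < \<rho>"
    moreover have "U n \<inter> cball x r \<noteq> {}" using that child_sub[of y] TS by blast
    ultimately have "n \<in> A" by (simp add: A_def)
    then show False using that by (auto simp: T_def K_def)
  qed
  have "(\<Sum>y\<in>T. weight (cball y \<rho>)) \<le> weight (cball x r)"
  proof (rule sum_weight_le[OF finT])
    have "3 * \<rho> < 1 / (real M)\<^sup>2"
      using \<rho>M M(3) order_le_less_trans[of "3 * \<rho>" "3 * (1 / (8 * (real M)\<^sup>2))" "1 / (real M)\<^sup>2"]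
      by (simp add: divide_strict_right_mono field_simps)
    then show "pairwise (\<lambda>y z. 3 * \<rho> < dist y z) T"
      using S(4) TS by (force simp: pairwise_def)
  qed (use child_sub TS small in auto)
  also have "\<dots> \<le> \<epsilon> * r powr s" using light by (simp add: light_def)
  finally have total: "(\<Sum>y\<in>T. weight (cball y \<rho>)) \<le> \<epsilon> * r powr s" .
  have "\<exists>y\<in>T. weight (cball y \<rho>) \<le> \<epsilon> * \<rho> powr s"
  proof (rule ccontr)
    assume "\<not> ?thesis"
    then have "real (card T) * (\<epsilon> * \<rho> powr s) \<le> (\<Sum>y\<in>T. weight (cball y \<rho>))"
      using sum_mono[of T "\<lambda>_. \<epsilon> * \<rho> powr s" "\<lambda>y. weight (cball y \<rho>)"] by force
    with total have "real (card T) * \<rho> powr s * \<epsilon> \<le> r powr s * \<epsilon>" by (simp add: mult_ac)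
    then have "real (card T) * \<rho> powr s \<le> r powr s" by (simp add: \<epsilon>_def)
    \<comment> \<open>The remaining children number at least \<open>c / 2 * (r ^ 4 * M ^ 8)\<close>,
      while \<open>scale\<close> was arranged with \<open>c / 4\<close>. This factor 2 yields the
      contradiction, also when \<open>T\<close> is empty.\<close>
    moreover have "2 * r powr s \<le> real (card T) * \<rho> powr s"
    proof -
      have "r powr s = r powr s * \<rho> powr (- s) * \<rho> powr s"
        using \<rho>0 by (simp add: powr_minus_divide)
      also have "\<dots> \<le> c / 4 * (r ^ 4 * real M ^ 8) * \<rho> powr s"
        by (intro mult_right_mono scale) auto
      finally have "2 * r powr s \<le> c / 2 * (r ^ 4 * real M ^ 8) * \<rho> powr s" by simp
      also have "\<dots> \<le> real (card T) * \<rho> powr s"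
        by (intro mult_right_mono cardT) auto
      finally show ?thesis .
    qed
    moreover have "0 < r powr s" using r by simp
    ultimately show False by linarith
  qed
  then obtain y where y: "y \<in> T" "weight (cball y \<rho>) \<le> \<epsilon> * \<rho> powr s" by blast
  then obtain p q where pq: "p \<in> lipschitz_integers" "q \<in> lipschitz_integers"
       "y = p * inverse q" "M / 40 \<le> norm q" "norm q \<le> 2 * M"
    using S(5) TS by blast
  have q0: "0 < norm q" using pq(4) M(3) by (simp del: zero_less_norm_iff)
  show ?thesis
  proof (rule that[of \<rho> y p q])
    show "light y \<rho>" using y small by (auto simp: light_def)
    show "norm (\<xi> - p * inverse q) < norm q powr (- v)" if "\<xi> \<in> cball y \<rho>" for \<xi>
    proof -
      have "norm (\<xi> - p * inverse q) \<le> \<rho>"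
        using that pq(3) by (simp add: dist_norm norm_minus_commute)
      also have "\<rho> < (2 * real M) powr (- v)" using \<rho>0 by (simp add: \<rho>_def)
      also have "\<dots> \<le> norm q powr (- v)"
        using q0 pq(5) v_gt_2 by (intro powr_mono2') auto
      finally show ?thesis .
    qed
    show "N \<le> norm q" using M(2) pq(4) by linarith
  qed (use \<rho>0 \<rho>r r child_sub TS y pq q0 in auto)
qed

text \<open>Iterating \<open>light_child\<close> gives nested light balls of radius at most
  \<open>(1/2) ^ k\<close> with a common point. A set \<open>U n\<close> containing that point meets
  all of them, so lightness forces \<open>d n\<close> below every radius, against
  \<open>d_pos\<close>.\<close>

lemma uncovered_point:
  assumes "0 < r" "r \<le> 1" "light x r"
  obtains \<xi> where "\<xi> \<in> cball x r" "\<xi> \<in> W_approx v" "\<And>n. \<xi> \<notin> U n"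
proof -
  define P where "P k b \<longleftrightarrow> 0 < snd b \<and> snd b \<le> (1/2) ^ k \<and> light (fst b) (snd b) \<and>
    cball (fst b) (snd b) \<subseteq> cball x r" for k :: nat and b :: "quat \<times> real"
  define Q where "Q k b b' \<longleftrightarrow> cball (fst b') (snd b') \<subseteq> cball (fst b) (snd b) \<and>
    (\<exists>p\<in>lipschitz_integers. \<exists>q\<in>lipschitz_integers. q \<noteq> 0 \<and> real k \<le> norm q \<and>
      (\<forall>\<xi>\<in>cball (fst b') (snd b'). norm (\<xi> - p * inverse q) < norm q powr (- v)))"
    for k :: nat and b b' :: "quat \<times> real"
  have "\<exists>f. \<forall>k. P k (f k) \<and> Q k (f k) (f (Suc k))"
  proof (rule dependent_nat_choice)
    show "\<exists>b. P 0 b" using assms by (intro exI[of _ "(x, r)"]) (simp add: P_def)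
    fix b k assume b: "P k b"
    have "(1/2 :: real) ^ k \<le> 1" by (simp add: power_le_one)
    with b have b1: "0 < snd b" "snd b \<le> 1" "light (fst b) (snd b)"
      unfolding P_def by linarith+
    obtain y \<rho> p q where *: "0 < \<rho>" "\<rho> \<le> snd b / 2" "cball y \<rho> \<subseteq> cball (fst b) (snd b)" "light y \<rho>"
      "p \<in> lipschitz_integers" "q \<in> lipschitz_integers" "q \<noteq> 0" "real k \<le> norm q"
      "\<And>\<xi>. \<xi> \<in> cball y \<rho> \<Longrightarrow> norm (\<xi> - p * inverse q) < norm q powr (- v)"
      by (rule light_child[OF b1, of "real k"]) (rule that; assumption)
    have "P (Suc k) (y, \<rho>)" using b * by (auto simp: P_def)
    moreover have "Q k b (y, \<rho>)" unfolding Q_def using *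
      by (intro conjI bexI[of _ p] bexI[of _ q] ballI) auto
    ultimately show "\<exists>b'. P (Suc k) b' \<and> Q k b b'" by blast
  qed
  then obtain f where P: "\<And>k. P k (f k)" and Q: "\<And>k. Q k (f k) (f (Suc k))" by blast
  define B where "B k = cball (fst (f k)) (snd (f k))" for k
  have "B (Suc k) \<subseteq> B k" for k using Q[of k] by (simp add: Q_def B_def)
  then have dec: "B n \<subseteq> B m" if "m \<le> n" for m n
    using that by (rule lift_Suc_antimono_le)
  have ne: "B k \<noteq> {}" for k using P[of k] by (simp add: P_def B_def)
  obtain \<xi> where \<xi>: "\<And>k. \<xi> \<in> B k"
  proof (rule bounded_closed_nest[of B])
    show "closed (B k)" "B k \<noteq> {}" "bounded (B 0)" for k
      using ne by (simp_all add: B_def)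
  qed (use dec in auto)
  have "\<xi> \<in> cball x r" using \<xi>[of 0] P[of 0] by (auto simp: P_def B_def)
  moreover have "\<xi> \<in> W_approx v"
  proof -
    let ?X = "{(p, q). p \<in> hurwitz_integers \<and> q \<in> hurwitz_integers \<and> q \<noteq> 0 \<and>
                      norm (\<xi> - p * inverse q) < norm q powr (- v)}"
    have "infinite ?X"
    proof
      assume "finite ?X"
      \<comment> \<open>Finitely many pairs would have bounded denominators, but stage
        \<open>k\<close> supplies one of norm at least \<open>k\<close>.\<close>
      then have "bdd_above ((\<lambda>u. norm (snd u)) ` ?X)" by (intro bdd_above_finite finite_imageI)
      then obtain b where b: "\<And>p q. (p, q) \<in> ?X \<Longrightarrow> norm q \<le> b" unfolding bdd_above_def by force
      obtain k :: nat where k: "b < real k" using reals_Archimedean2 by blast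
      obtain p q where pq: "p \<in> lipschitz_integers" "q \<in> lipschitz_integers" "q \<noteq> 0" "real k \<le> norm q"
        "norm (\<xi> - p * inverse q) < norm q powr (- v)"
        using Q[of k] \<xi>[of "Suc k"] unfolding Q_def B_def by blast
      then have "(p, q) \<in> ?X" using lipschitz_subset_hurwitz by auto
      from b[OF this] k pq(4) show False by linarith
    qed
    then show ?thesis by (simp add: W_approx_def)
  qed
  moreover have "\<xi> \<notin> U n" for n
  proof
    assume "\<xi> \<in> U n"
    then have "d n < snd (f k)" for k
      using P[of k] \<xi>[of k] unfolding P_def light_def B_def by blast
    then have "d n \<le> (1/2) ^ k" for k using P[of k] unfolding P_def by (meson less_le_trans less_imp_le)
    moreover obtain k where "(1/2 :: real) ^ k < d n" using real_arch_pow_inv[of "d n" "1/2"] d_pos by auto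
    ultimately show False by (meson not_le)
  qed
  ultimately show ?thesis by (rule that)
qed

end

text \<open>A cover of sufficiently small total weight makes a ball inside
  \<open>Delta_closure\<close> light, and \<open>uncovered_point\<close> then finds a point of
  \<open>V_approx v\<close> that the cover misses.\<close>

lemma hausdorff_measure_V_approx_neq_0:
  assumes s: "0 < s" and v: "2 < v" and sv: "s * v < 8"
  shows "hausdorff_measure s (V_approx v) \<noteq> 0"
proof
  assume "hausdorff_measure s (V_approx v) = 0"
  then have prem: "hausdorff_premeasure s 1 (V_approx v) = 0"
    by (simp add: hausdorff_measure_eq_0_iff)
  \<comment> \<open>The weight allowed in a light ball of radius 1/4, with \<open>\<epsilon>\<close>
    written out because the locale is interpreted only later.\<close>
  define \<eta> :: real where "\<eta> = 1 / (32 * 81 ^ 4) / (16 * 1297) * (1/4) powr s"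
  have \<eta>: "0 < \<eta>" by (simp add: \<eta>_def)
  obtain U where U: "V_approx v \<subseteq> (\<Union>n. U n)" "\<And>n. bounded (U n)"
    and lt: "(\<Sum>n. diam_powr s (U n)) < ennreal (\<eta> / 4)"
    using INF_approx_ennreal[of "\<eta> / 4", OF _ hausdorff_premeasure_def[of s 1 "V_approx v"]] \<eta> prem by auto
  define D where "D n = diameter (U n) powr s" for n
  have D: "diam_powr s (U n) = ennreal (D n)" for n
    using s by (simp add: diam_powr_def D_def)
  have sumD: "summable D"
    using lt unfolding D by (intro summable_suminf_not_top) (auto simp: D_def)
  have D_less: "suminf D < \<eta> / 4"
    using lt unfolding D by (subst (asm) suminf_ennreal2[OF _ sumD]) (auto simp: D_def ennreal_less_iff suminf_nonneg sumD)
  \<comment> \<open>A covering set may have diameter 0, whereas the locale needs positive sizes. The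
    geometric term repairs this and adds only \<open>\<eta> / 4\<close> to the total.\<close>
  define E where "E n = D n + \<eta> / 4 * (1/2) ^ Suc n" for n
  define d where "d n = E n powr (1 / s)" for n
  have E_pos: "0 < E n" for n
    using \<eta> by (auto simp: E_def D_def intro!: add_nonneg_pos)
  have dE: "d n powr s = E n" for n
    using s E_pos[of n] by (simp add: d_def powr_powr)
  have "(\<lambda>n. \<eta> / 4 * (1/2) ^ Suc n) sums (\<eta> / 4 * 1)"
    by (intro sums_mult power_half_series)
  then have "E sums (suminf D + \<eta> / 4 * 1)"
    unfolding E_def by (intro sums_add summable_sums sumD)
  then have sumE: "summable E" "suminf E < \<eta>"
    using D_less \<eta> by (auto simp: sums_iff)
  interpret light_cover U d s v
  proof
    show "0 < d n" for n using E_pos[of n] by (simp add: d_def)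
    show "dist a b \<le> d n" if "a \<in> U n" "b \<in> U n" for n a b
    proof -
      have "dist a b \<le> diameter (U n)" using U(2) that by (rule diameter_bounded_bound)
      also have "\<dots> = D n powr (1 / s)"
        using s diameter_ge_0[OF U(2)] by (simp add: D_def powr_powr)
      also have "\<dots> \<le> d n"
        unfolding d_def using s \<eta> by (intro powr_mono2) (auto simp: D_def E_def)
      finally show ?thesis .
    qed
    show "summable (\<lambda>n. d n powr s)" using sumE by (simp add: dE)
  qed (use assms in auto)
  \<comment> \<open>The centre of \<open>Delta_closure\<close>; 1/4 is its distance to the boundary,
    because the last coordinate ranges over an interval of length 1/2.\<close>
  define x where "x = Quat (1/2) (1/2) (1/2) (1/4)"
  have "light x (1/4)"
    unfolding light_def
  proof (intro conjI allI impI)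
    fix n
    have "d n powr s \<le> suminf E"
      using sum_le_suminf[OF sumE(1), of "{n}"] E_pos by (simp add: dE less_imp_le)
    also have "\<dots> < \<eta>" by (rule sumE)
    also have "\<eta> \<le> 1 * (1/4) powr s" unfolding \<eta>_def by (intro mult_right_mono) auto
    finally have "d n powr s < (1/4) powr s" by simp
    then show "d n < 1/4" using s powr_mono2[of s "1/4" "d n"] by (meson less_imp_le not_le zero_le_divide_1_iff zero_le_numeral)
  next
    have "weight (cball x (1/4)) \<le> suminf E" using weight_le_suminf by (simp add: dE)
    also have "\<dots> \<le> \<epsilon> * (1/4) powr s" using sumE(2) by (simp add: \<eta>_def \<epsilon>_def)
    finally show "weight (cball x (1/4)) \<le> \<epsilon> * (1/4) powr s" .
  qed
  then obtain \<xi> where \<xi>: "\<xi> \<in> cball x (1/4)" "\<xi> \<in> W_approx v" "\<And>n. \<xi> \<notin> U n"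
    using uncovered_point[of "1/4" x] by auto
  have "norm (\<xi> - x) \<le> 1/4" using \<xi>(1) by (simp add: dist_norm norm_minus_commute)
  then have "\<xi> \<in> Delta_closure"
    using abs_component_le_norm[of "\<xi> - x"] by (simp add: Delta_closure_def x_def) linarith
  then show False using \<xi> U(1) by (auto simp: V_approx_def)
qed

lemma hausdorff_dim_V_approx_ge:
  assumes v: "2 < v"
  shows "ennreal (8 / v) \<le> hausdorff_dim (V_approx v)"
  unfolding hausdorff_dim_def
proof (rule INF_greatest)
  fix s assume "s \<in> {s. 0 \<le> s \<and> hausdorff_measure s (V_approx v) = 0}"
  then have s: "0 \<le> s" "hausdorff_measure s (V_approx v) = 0" by auto
  have "\<not> s < 8 / v"
  proof
    assume "s < 8 / v"
    then have "s * v < 8" using v by (simp add: field_simps)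
    \<comment> \<open>The exponent 0 needs its own argument: each nonempty set counts 1, so a total
      below 1 leaves only empty sets and \<open>V_approx v\<close> would be empty. The positive
      exponent \<open>1 / v\<close> refutes that.\<close>
    then have "s = 0" using hausdorff_measure_V_approx_neq_0[of s v] s v by force
    then have "hausdorff_premeasure 0 1 (V_approx v) = 0"
      using s by (simp add: hausdorff_measure_eq_0_iff)
    then obtain U where U: "V_approx v \<subseteq> (\<Union>n. U n)" and lt: "(\<Sum>n. diam_powr 0 (U n)) < 1"
      using INF_approx_ennreal[of 1, OF _ hausdorff_premeasure_def[of 0 1 "V_approx v"]] by auto
    have "U n = {}" for n
      using ennreal_suminf_lessD[OF lt, of n] by (auto simp: diam_powr_def split: if_splits)
    then have "V_approx v = {}" using U by auto
    then have "hausdorff_measure (1 / v) (V_approx v) = 0"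
      by (simp add: hausdorff_measure_eq_0_iff)
    then show False using hausdorff_measure_V_approx_neq_0[of "1 / v" v] v by simp
  qed
  then show "ennreal (8 / v) \<le> ennreal s" by (intro ennreal_leI) simp
qed

section \<open>Upper bound\<close>

lemma hausdorff_dim_leI:
  assumes "0 \<le> t" "\<And>s. t < s \<Longrightarrow> hausdorff_measure s A = 0"
  shows "hausdorff_dim A \<le> ennreal t"
proof (rule ennreal_le_epsilon)
  fix e :: real assume e: "0 < e"
  have "hausdorff_dim A \<le> ennreal (t + e)"
    unfolding hausdorff_dim_def using assms e by (intro INF_lower) auto
  then show "hausdorff_dim A \<le> ennreal t + ennreal e" using assms e by simp
qed

section \<open>Dyadic series and the ambient dimension 4\<close>

lemma powr_two_power: "((2::real) ^ k) powr t = (2 powr t) ^ k"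
  by (simp add: powr_powr mult.commute flip: powr_realpow)

lemma dyadic_tendsto_0:
  assumes "0 < w" shows "(\<lambda>k. b * ((2::real) ^ k) powr (- w)) \<longlonglongrightarrow> 0"
proof -
  have "(2::real) powr (- w) < 1" using assms powr_less_mono[of "- w" 0 "2::real"] by simp
  then have "(\<lambda>k. ((2::real) powr (- w)) ^ k) \<longlonglongrightarrow> 0" by (intro LIMSEQ_realpow_zero) auto
  then have "(\<lambda>k. b * ((2::real) powr (- w)) ^ k) \<longlonglongrightarrow> b * 0" by (intro tendsto_mult_left)
  then show ?thesis by (simp add: powr_two_power)
qed

text \<open>Comparison with a geometric series of ratio \<open>2 powr (a - w * s) < 1\<close>. It is
  applied with \<open>a = 4\<close> to grids and with \<open>a = 8\<close> to ratios.\<close>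

lemma summable_dyadic:
  fixes N :: "nat \<Rightarrow> nat"
  assumes a: "real a < w * s" and b: "0 \<le> b" and N: "\<And>k. real (N k) \<le> C * (2 ^ k) ^ a"
  shows "summable (\<lambda>k. real (N k) * (2 * (b * (2 ^ k) powr (- w))) powr s)"
proof (rule summable_comparison_test')
  have "(2::real) powr (a - w * s) < 1" using a powr_less_mono[of "a - w * s" 0 "2::real"] by simp
  then show "summable (\<lambda>k. C * (2 * b) powr s * (2 powr (a - w * s)) ^ k)"
    by (intro summable_mult summable_geometric) auto
  fix k :: nat assume "k \<ge> 0"
  have "norm (real (N k) * (2 * (b * (2 ^ k) powr (- w))) powr s)
      = real (N k) * ((2 * b) powr s * (2 ^ k) powr (- (w * s)))"
    using b by (simp add: powr_powr powr_mult mult_ac)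
  also have "\<dots> \<le> C * (2 ^ k) ^ a * ((2 * b) powr s * (2 ^ k) powr (- (w * s)))"
    by (intro mult_right_mono N) auto
  also have "\<dots> = C * (2 * b) powr s * ((2 ^ k) powr a * (2 ^ k) powr (- (w * s)))"
    by (simp add: powr_realpow)
  also have "(2 ^ k :: real) powr a * (2 ^ k) powr (- (w * s)) = (2 powr (a - w * s)) ^ k"
    by (simp only: powr_add[symmetric]) (simp add: powr_two_power)
  finally show "norm (real (N k) * (2 * (b * (2 ^ k) powr (- w))) powr s)
      \<le> C * (2 * b) powr s * (2 powr (a - w * s)) ^ k" .
qed

text \<open>Hausdorff-Cantelli for the grids of mesh \<open>1 / 2 ^ k\<close>: at every level each
  point of a fixed ball is near one of \<open>O(2 ^ (4 * k))\<close> grid points.\<close>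

lemma hausdorff_measure_UNIV_quat:
  assumes "4 < s"
  shows "hausdorff_measure s (UNIV :: quat set) = 0"
proof -
  have "hausdorff_measure s (cball (0 :: quat) (real n)) = 0" for n
  proof (rule hausdorff_measure_limsup_eq_0)
    \<comment> \<open>Rounding moves a point by at most 2, so the rounded \<open>2 ^ k\<close>
      multiple has norm at most \<open>2 ^ k * n + 2\<close>.\<close>
    define T where "T k = (real n + 2) * 2 ^ k" for k :: nat
    define F where "F k = (\<lambda>p. (1 / 2 ^ k) *\<^sub>R p) ` (lipschitz_integers \<inter> cball 0 (T k))" for k :: nat
    have T: "0 \<le> T k" for k by (simp add: T_def)
    show "finite (F k)" for k using lipschitz_integers_cball(1)[OF T] by (simp add: F_def)
    have "real (card (F k)) \<le> (2 * real n + 5) ^ 4 * (2 ^ k) ^ 4" for k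
    proof -
      have "card (F k) \<le> card (lipschitz_integers \<inter> cball 0 (T k))"
        unfolding F_def by (intro card_image_le lipschitz_integers_cball T)
      then have "real (card (F k)) \<le> (2 * T k + 1) ^ 4"
        using lipschitz_integers_cball(2)[OF T, of 0 k] by linarith
      also have "\<dots> \<le> ((2 * real n + 5) * 2 ^ k) ^ 4"
        using T[of k] by (intro power_mono) (auto simp: T_def algebra_simps)
      finally show ?thesis by (simp add: power_mult_distrib)
    qed
    then show "summable (\<lambda>k. real (card (F k)) * (2 * (2 * (2 ^ k) powr (- 1))) powr s)"
      using assms by (intro summable_dyadic[where a = 4]) auto
    show "(\<lambda>k. 2 * ((2::real) ^ k) powr (- 1)) \<longlonglongrightarrow> 0" by (rule dyadic_tendsto_0) simp
    fix \<xi> :: quat assume \<xi>: "\<xi> \<in> cball 0 (real n)"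
    have "\<exists>y\<in>F k. dist \<xi> y \<le> 2 * (2 ^ k) powr (- 1)" for k
    proof -
      define p where "p = quat_floor ((2 ^ k) *\<^sub>R \<xi>)"
      have p: "norm ((2 ^ k) *\<^sub>R \<xi> - p) \<le> 2" unfolding p_def by (rule norm_diff_quat_floor_le)
      have "norm p \<le> norm ((2 ^ k) *\<^sub>R \<xi>) + norm ((2 ^ k) *\<^sub>R \<xi> - p)"
        by (metis norm_minus_commute norm_triangle_sub)
      also have "\<dots> \<le> 2 ^ k * real n + 2" using \<xi> p by (intro add_mono) auto
      also have "\<dots> \<le> T k" by (simp add: T_def algebra_simps)
      finally have "(1 / 2 ^ k) *\<^sub>R p \<in> F k" by (auto simp: F_def p_def)
      moreover have "\<xi> - (1 / 2 ^ k) *\<^sub>R p = (1 / 2 ^ k) *\<^sub>R ((2 ^ k) *\<^sub>R \<xi> - p)"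
        by (simp add: scaleR_diff_right)
      then have "dist \<xi> ((1 / 2 ^ k) *\<^sub>R p) \<le> 2 * (2 ^ k) powr (- 1)"
        using p by (simp add: dist_norm powr_minus_divide divide_right_mono)
      ultimately show ?thesis by blast
    qed
    then show "\<exists>\<^sub>\<infinity>k. \<exists>y\<in>F k. dist \<xi> y \<le> 2 * (2 ^ k) powr (- 1)"
      by (simp add: INFM_nat_le)
  qed (use assms in auto)
  then have "hausdorff_measure s (\<Union>n. cball (0 :: quat) (real n)) = 0"
    by (rule hausdorff_measure_UN_eq_0)
  moreover have "(\<Union>n. cball (0 :: quat) (real n)) = UNIV"
    by (auto simp: real_arch_simple)
  ultimately show ?thesis by simp
qed

section \<open>Hurwitz integers and the bound 8 / v\<close>

lemma hurwitz_double: "x \<in> hurwitz_integers \<Longrightarrow> x + x \<in> lipschitz_integers"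
proof -
  have "t + t \<in> \<int>" if "t - 1/2 \<in> \<int>" for t :: real
  proof -
    have "2 * (t - 1/2) + 1 \<in> \<int>" using that by (intro Ints_add Ints_mult) auto
    then show ?thesis by simp
  qed
  then show "x + x \<in> lipschitz_integers" if "x \<in> hurwitz_integers"
    using that by (auto simp: hurwitz_integers_def lipschitz_integers_def)
qed

text \<open>In the half-integral case all four coordinates have absolute value at least 1/2, and
  four quarters add up to 1.\<close>

lemma hurwitz_norm_ge_1:
  assumes "x \<in> hurwitz_integers" "x \<noteq> 0"
  shows "1 \<le> norm x"
proof (cases "x \<in> lipschitz_integers")
  case True
  then show ?thesis using assms lipschitz_integers_norm_ge_1 by blast
next
  case False
  have *: "(1/2)\<^sup>2 \<le> t\<^sup>2" if half: "t - 1/2 \<in> \<int>" for t :: real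
  proof -
    obtain k :: int where "t - 1/2 = k" using half by (auto elim: Ints_cases)
    moreover have "0 \<le> k \<or> k \<le> -1" by linarith
    then have "0 \<le> real_of_int k \<or> real_of_int k \<le> -1" by linarith
    ultimately have "1/2 \<le> \<bar>t\<bar>" by linarith
    then show ?thesis by (metis abs_le_square_iff abs_of_nonneg zero_le_divide_1_iff zero_le_numeral)
  qed
  have "(1::real) \<le> (qRe x)\<^sup>2 + (qIm1 x)\<^sup>2 + (qIm2 x)\<^sup>2 + (qIm3 x)\<^sup>2"
    using False assms(1) *[of "qRe x"] *[of "qIm1 x"] *[of "qIm2 x"] *[of "qIm3 x"]
    by (auto simp: hurwitz_integers_def lipschitz_integers_def power2_eq_square)
  then show ?thesis by (simp add: norm_quat_def)
qed

text \<open>Doubling is injective and maps Hurwitz integers to quaternions with integer coordinates,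
  which are already counted.\<close>

lemma hurwitz_cball:
  assumes "0 \<le> T"
  shows "finite (hurwitz_integers \<inter> cball 0 T)"
    and "real (card (hurwitz_integers \<inter> cball 0 T)) \<le> (4 * T + 1) ^ 4"
proof -
  let ?f = "\<lambda>x :: quat. x + x"
  have inj: "inj_on ?f (hurwitz_integers \<inter> cball 0 T)"
    by (auto simp: inj_on_def quat_eq_iff)
  have sub: "?f ` (hurwitz_integers \<inter> cball 0 T) \<subseteq> lipschitz_integers \<inter> cball 0 (2 * T)"
    using hurwitz_double norm_triangle_mono[of _ T _ T] by force
  have L: "finite (lipschitz_integers \<inter> cball 0 (2 * T))"
    "real (card (lipschitz_integers \<inter> cball 0 (2 * T))) \<le> (2 * (2 * T) + 1) ^ 4"
    using assms by (intro lipschitz_integers_cball; simp)+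
  show "finite (hurwitz_integers \<inter> cball 0 T)"
    using inj sub L(1) by (rule inj_on_finite)
  have "card (hurwitz_integers \<inter> cball 0 T) \<le> card (lipschitz_integers \<inter> cball 0 (2 * T))"
    using inj sub L(1) by (rule card_inj_on_le)
  then show "real (card (hurwitz_integers \<inter> cball 0 T)) \<le> (4 * T + 1) ^ 4"
    using L(2) by simp
qed

lemma dyadic_interval:
  fixes t :: real
  assumes "1 \<le> t"
  obtains k :: nat where "2 ^ k \<le> t" "t < 2 ^ Suc k"
proof -
  obtain m where m: "t < 2 ^ m" "\<And>i. i < m \<Longrightarrow> \<not> t < 2 ^ i"
    using exists_least_iff[of "\<lambda>m. t < 2 ^ m"] real_arch_pow[of 2 t] by auto
  then obtain k where "m = Suc k" using assms by (cases m) auto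
  then show ?thesis using m that[of k] by force
qed

text \<open>On a bounded piece the approximating pairs fall into finite dyadic blocks
  \<open>PQ k\<close>, so infinitely many pairs occupy infinitely many blocks, as Hausdorff-Cantelli
  requires. Block \<open>k\<close> has \<open>O(2 ^ (8 * k))\<close> ratios.\<close>

lemma hausdorff_measure_W_approx_eq_0:
  assumes v: "0 \<le> v" and s: "0 < s" "8 < v * s"
  shows "hausdorff_measure s (W_approx v) = 0"
proof -
  let ?H = hurwitz_integers
  have v0: "0 < v" using v s by (cases "v = 0") auto
  have "hausdorff_measure s (W_approx v \<inter> cball 0 (real n)) = 0" for n
  proof (rule hausdorff_measure_limsup_eq_0)
    \<comment> \<open>For \<open>norm \<xi> \<le> n\<close> the ratio has norm at most
      \<open>n + 1\<close>, because \<open>norm q powr (- v) \<le> 1\<close>; and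
      \<open>norm q < 2 ^ Suc k\<close>.\<close>
    define T where "T k = (real n + 1) * 2 ^ Suc k" for k :: nat
    define PQ where "PQ k = (?H \<inter> cball 0 (T k)) \<times> (?H \<inter> cball 0 (2 ^ Suc k))" for k
    define F where "F k = (\<lambda>(p, q). p * inverse q) ` PQ k" for k
    have T: "0 \<le> T k" and T2: "(0::real) \<le> 2 ^ Suc k" for k by (simp_all add: T_def)
    have finPQ: "finite (PQ k)" for k
      unfolding PQ_def by (intro finite_cartesian_product hurwitz_cball T T2)
    then show "finite (F k)" for k by (simp add: F_def)
    have "real (card (F k)) \<le> ((8 * real n + 9) * 9) ^ 4 * (2 ^ k) ^ 8" for k
    proof -
      have "card (F k) \<le> card (PQ k)"
        unfolding F_def by (rule card_image_le[OF finPQ])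
      also have "\<dots> = card (?H \<inter> cball 0 (T k)) * card (?H \<inter> cball 0 (2 ^ Suc k))"
        by (simp add: PQ_def card_cartesian_product)
      finally have "real (card (F k)) \<le> real (card (?H \<inter> cball 0 (T k))) * real (card (?H \<inter> cball 0 (2 ^ Suc k)))"
        by (metis of_nat_le_iff of_nat_mult)
      also have "\<dots> \<le> (4 * T k + 1) ^ 4 * (4 * 2 ^ Suc k + 1) ^ 4"
        using T[of k] by (intro mult_mono hurwitz_cball T T2) auto
      also have "\<dots> \<le> ((8 * real n + 9) * 2 ^ k) ^ 4 * (9 * 2 ^ k) ^ 4"
        using T[of k] by (intro mult_mono power_mono) (auto simp: T_def algebra_simps)
      also have "\<dots> = ((8 * real n + 9) * 9) ^ 4 * ((2 ^ k) ^ 4 * (2 ^ k) ^ 4)"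
        by (simp only: power_mult_distrib mult_ac)
      also have "(2 ^ k :: real) ^ 4 * (2 ^ k) ^ 4 = (2 ^ k) ^ 8"
        by (simp flip: power_add)
      finally show ?thesis .
    qed
    then show "summable (\<lambda>k. real (card (F k)) * (2 * (1 * (2 ^ k) powr (- v))) powr s)"
      using s by (intro summable_dyadic[where a = 8]) auto
    show "(\<lambda>k. 1 * ((2::real) ^ k) powr (- v)) \<longlonglongrightarrow> 0"
      using v0 by (rule dyadic_tendsto_0)
    fix \<xi> :: quat assume \<xi>: "\<xi> \<in> W_approx v \<inter> cball 0 (real n)"
    let ?X = "{(p, q). p \<in> ?H \<and> q \<in> ?H \<and> q \<noteq> 0 \<and> norm (\<xi> - p * inverse q) < norm q powr (- v)}"
    let ?K = "{k. \<exists>y\<in>F k. dist \<xi> y \<le> 1 * (2 ^ k) powr (- v)}"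
    have "?X \<subseteq> (\<Union>k\<in>?K. PQ k)"
    proof
      fix u assume "u \<in> ?X"
      then obtain p q where u: "u = (p, q)" "p \<in> ?H" "q \<in> ?H" "q \<noteq> 0"
        "norm (\<xi> - p * inverse q) < norm q powr (- v)" by auto
      have q1: "1 \<le> norm q" using u hurwitz_norm_ge_1 by blast
      then obtain k where k: "2 ^ k \<le> norm q" "norm q < 2 ^ Suc k" by (rule dyadic_interval)
      have le: "norm q powr (- v) \<le> (2 ^ k) powr (- v)" using k v by (intro powr_mono2') auto
      have "norm q powr (- v) \<le> norm q powr 0" using q1 v by (intro powr_mono) auto
      then have "norm (\<xi> - p * inverse q) \<le> 1" using u(4,5) by simp
      then have "norm (p * inverse q) \<le> real n + 1"
        using \<xi> norm_triangle_sub[of "p * inverse q" \<xi>] by (simp add: norm_minus_commute)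
      moreover have "norm p = norm (p * inverse q) * norm q"
        using u(4) by (simp add: norm_mult norm_inverse)
      ultimately have "norm p \<le> T k"
        unfolding T_def using k by (metis less_imp_le mult_mono norm_ge_zero of_nat_0_le_iff add_nonneg_nonneg zero_le_one)
      then have "u \<in> PQ k" using u k by (simp add: PQ_def)
      moreover have "p * inverse q \<in> F k" using \<open>u \<in> PQ k\<close> u(1) by (force simp: F_def)
      then have "k \<in> ?K" using u(5) le by (auto simp: dist_norm intro!: bexI)
      ultimately show "u \<in> (\<Union>k\<in>?K. PQ k)" by blast
    qed
    moreover have "infinite ?X" using \<xi> by (simp add: W_approx_def)
    ultimately have "infinite ?K" using finPQ by (meson finite_UN_I finite_subset)
    then show "\<exists>\<^sub>\<infinity>k. \<exists>y\<in>F k. dist \<xi> y \<le> 1 * (2 ^ k) powr (- v)"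
      by (simp add: frequently_cofinite)
  qed (use s in auto)
  then have "hausdorff_measure s (\<Union>n. W_approx v \<inter> cball 0 (real n)) = 0"
    by (rule hausdorff_measure_UN_eq_0)
  moreover have "(\<Union>n. W_approx v \<inter> cball 0 (real n)) = W_approx v"
    by (auto simp: real_arch_simple)
  ultimately show ?thesis by simp
qed

text \<open>Nonzero denominators have norm at least 1, so a larger exponent is a stronger condition
  on each pair.\<close>

lemma V_approx_antimono:
  assumes "v \<le> w"
  shows "V_approx w \<subseteq> V_approx v"
proof -
  have "norm q powr (- w) \<le> norm q powr (- v)" if "q \<in> hurwitz_integers" "q \<noteq> 0" for q
    using that assms hurwitz_norm_ge_1 by (intro powr_mono) auto
  then have "{(p, q). p \<in> hurwitz_integers \<and> q \<in> hurwitz_integers \<and> q \<noteq> 0 \<and>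
                norm (\<xi> - p * inverse q) < norm q powr (- w)}
      \<subseteq> {(p, q). p \<in> hurwitz_integers \<and> q \<in> hurwitz_integers \<and> q \<noteq> 0 \<and>
                norm (\<xi> - p * inverse q) < norm q powr (- v)}" for \<xi>
    by (auto intro: less_le_trans)
  then show ?thesis
    unfolding V_approx_def W_approx_def using infinite_super by blast
qed

section \<open>The dimension formula\<close>

theorem theorem6p6:
  fixes v :: real
  assumes "v \<ge> 0"
  shows "hausdorff_dim (W_approx v) = hausdorff_dim (V_approx v)
       \<and> hausdorff_dim (V_approx v) = ennreal (if v \<le> 2 then 4 else 8 / v)"
proof -
  let ?t = "if v \<le> 2 then 4 else 8 / v"
  have "hausdorff_dim (V_approx v) \<le> hausdorff_dim (W_approx v)"
    by (rule hausdorff_dim_mono) (simp add: V_approx_def)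
  moreover have "hausdorff_dim (W_approx v) \<le> ennreal ?t"
  proof (rule hausdorff_dim_leI)
    fix s assume s: "?t < s"
    show "hausdorff_measure s (W_approx v) = 0"
    proof (cases "v \<le> 2")
      case True
      then have "hausdorff_measure s (UNIV :: quat set) = 0"
        using s by (intro hausdorff_measure_UNIV_quat) simp
      then show ?thesis
        using hausdorff_measure_mono[of "W_approx v" UNIV s] by simp
    next
      case False
      then have "8 / v < s" "0 < v" using s by auto
      moreover from this have "0 < s" by (meson divide_pos_pos less_trans zero_less_numeral)
      ultimately show ?thesis
        using assms by (intro hausdorff_measure_W_approx_eq_0) (auto simp: field_simps)
    qed
  qed auto
  moreover have "ennreal ?t \<le> hausdorff_dim (V_approx v)"
  proof (cases "v \<le> 2")
    case True
    have "ennreal 4 \<le> hausdorff_dim (V_approx v)"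
    proof (rule ennreal_le_epsilon)
      fix e :: real assume e: "0 < e"
      define e' where "e' = min e 1"
      \<comment> \<open>An exponent just above 2 whose lower bound \<open>8 / w\<close> is
        \<open>4 - e'\<close>; capping \<open>e\<close> at 1 keeps the denominator positive.\<close>
      define w where "w = 8 / (4 - e')"
      have e': "0 < e'" "e' \<le> 1" "e' \<le> e" using e by (auto simp: e'_def)
      then have w: "2 < w" "8 / w = 4 - e'" by (auto simp: w_def field_simps)
      have "ennreal (4 - e') \<le> hausdorff_dim (V_approx w)"
        using hausdorff_dim_V_approx_ge[OF w(1)] w(2) by simp
      also have "\<dots> \<le> hausdorff_dim (V_approx v)"
        using True w by (intro hausdorff_dim_mono V_approx_antimono) auto
      finally have "ennreal (4 - e') + ennreal e' \<le> hausdorff_dim (V_approx v) + ennreal e"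
        using e' by (intro add_mono ennreal_leI) auto
      then show "ennreal 4 \<le> hausdorff_dim (V_approx v) + ennreal e"
        using e' by (simp flip: ennreal_plus)
    qed
    with True show ?thesis by simp
  next
    case False
    then show ?thesis using hausdorff_dim_V_approx_ge[of v] by simp
  qed
  ultimately show ?thesis by (auto intro: order_antisym order_trans)
qed

end
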